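(* Let $\mathcal{G}$ be an ultragraph, $R$ a field, $X=\{D_A,R_e,g_e\}_{e\in\mathcal{G}^1,A\in\mathcal{G}^0}$ a perfect $\mathcal{G}$-branching system, and $\psi:L_R(\mathcal{G})\rightarrow \mathrm{End}_R(M(X))$ the associated representation. Then $\psi$ is irreducible if, and only if, $X$ is isomorphic, as a branching system, to the branching system $[p]$ for some equivalence class $[p]$ of elements of $\mathfrak{p}^*\cup\mathfrak{p}^\infty$.
   Context: An ultragraph is a quadruple $\mathcal{G}=(G^0,\mathcal{G}^1,r,s)$ where $G^0,\mathcal{G}^1$ are countable sets, $s:\mathcal{G}^1\to G^0$ and $r:\mathcal{G}^1\to P(G^0)\setminus\{\emptyset\}$ are maps. $\mathcal{G}^0$ is the smallest subset of $P(G^0)$ containing $\{v\}$ for all $v\in G^0$ and $r(e)$ for all $e\in\mathcal{G}^1$, and closed under finite unions and non-empty finite intersections. A vertex $v$ is a sink if $s^{-1}(v)=\emptyset$; $G^0_s$ is the set of sinks. $L_R(\mathcal{G})$ is the universal (not necessarily unital) $R$-algebra with generators $\{s_e,s_e^*:e\in\mathcal{G}^1\}\cup\{p_A:A\in\mathcal{G}^0\}$ and relations: (1) $p_\emptyset=0$, $p_Ap_B=p_{A\cap B}$, $p_{A\cup B}=p_A+p_B-p_{A\cap B}$ for all $A,B\in\mathcal{G}^0$; (2) $p_{s(e)}s_e=s_ep_{r(e)}=s_e$ and $p_{r(e)}s_e^*=s_e^*p_{s(e)}=s_e^*$ for each $e$; (3) $s_e^*s_f=\delta_{e,f}p_{r(e)}$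 for all $e,f$; (4) $p_v=\sum_{s(e)=v}s_es_e^*$ whenever $0<|s^{-1}(v)|<\infty$ (where $p_v=p_{\{v\}}$). A representation on an $R$-module $M$ is an $R$-algebra homomorphism $L_R(\mathcal{G})\to \mathrm{End}_R(M)$; it is irreducible if $M\ne0$ and the only invariant submodules of $M$ are $0$ and $M$. A $\mathcal{G}$-branching system on a set $X$ is a family $\{D_A,R_e,g_e\}_{e\in\mathcal{G}^1,A\in\mathcal{G}^0}$ with $D_A,R_e\subseteq X$ such that: $R_e\cap R_f=\emptyset$ if $e\ne f$; $D_\emptyset=\emptyset$, $D_A\cap D_B=D_{A\cap B}$, $D_A\cup D_B=D_{A\cup B}$ for all $A,B\in\mathcal{G}^0$; $R_e\subseteq D_{s(e)}$; $D_v=\bigcup_{e\in s^{-1}(v)}R_e$ if $0<|s^{-1}(v)|<\infty$; and each $g_e:D_{r(e)}\to R_e$ is a bijection (here $D_v=D_{\{v\}}$). The branching system itself is also denoted $X$. It is perfect if $X=\bigcup_{v\in G^0}D_v$ and $D_v=\bigcup_{e\in s^{-1}(v)}R_e$ for each non-sink $v\in G^0$. $M(X)$ is the $R$-module of maps $X\to R$ with finite support. The representation associated to (induced by) $X$ is $\psi:L_R(\mathcal{G})\to \mathrm{End}_R(M(X))$ given by $\psi(p_A)(\phi)=\chi_{D_A}\cdot\phi$, $\psi(s_e)(\phi)=\chi_{R_e}\cdot(\phi\circ g_e^{-1})$, $\psi(s_e^* )(\phi)=\chi_{D_{r(e)}}\cdot(\phi\circ g_e)$ (products extended by $0$ outside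 $R_e$, respectively $D_{r(e)}$). A morphism of branching systems from $X=\{D_A,R_e,g_e\}$ to $Y=\{B_A,L_e,f_e\}$ is a map $T:X\to Y$ with $T(R_e)\subseteq L_e$, $T(D_A)\subseteq B_A$, and $T\circ g_e=f_e\circ T$ on $D_{r(e)}$, for all $e$ and $A$. $X$ and $Y$ are isomorphic if there are mutually inverse morphisms $X\to Y$ and $Y\to X$. A finite path of length $n\ge1$ is a sequence of edges $\alpha=e_1\dots e_n$ with $s(e_{i+1})\in r(e_i)$ for $1\le i\le n-1$; $s(\alpha)=s(e_1)$, $r(\alpha)=r(e_n)$. An infinite path is a sequence $e_1e_2e_3\dots$ of edges with $s(e_{i+1})\in r(e_i)$ for all $i\ge1$, with source $s(e_1)$. $\mathfrak{p}^\infty$ is the set of infinite paths, and $\mathfrak{p}^*=\{(\alpha,v):\alpha \text{ a finite path of length}\ge1,\ v\in r(\alpha)\cap G^0_s\}\cup\{(v,v):v\in G^0_s\}$, with $s(\alpha,v)=s(\alpha)$, $s(v,v)=v$; the first edge of $(\alpha,v)$, $|\alpha|\ge1$, is $\alpha_1$, and $(v,v)$ has no first edge. Elements $\alpha,\beta\in\mathfrak{p}^*\cup\mathfrak{p}^\infty$ are equivalent if either $\alpha,\beta\in\mathfrak{p}^\infty$ and there are $i,j\ge0$ with $\alpha_{i+k}=\beta_{j+k}$ for all $k\ge1$, or $\alpha,\beta\in\mathfrak{p}^*$ with $\alpha=(a,v)$, $\beta=(b,v)$ for the same sink $v$. $[p]$ denotes the equivalence class of $p$. The set $\mathfrak{p}^*\cup\mathfrak{p}^\infty$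 carries the branching system $B_A=\{x:s(x)\in A\}$, $L_e=\{x:x_1=e\}$, $f_e:B_{r(e)}\to L_e$, $f_e(x)=ex$, where $e(\alpha,v)=(e\alpha,v)$ for $|\alpha|\ge1$ and $e(v,v)=(e,v)$. Each class $[p]$ is regarded as a branching system $\{B_A\cap[p],L_e\cap[p],f_e|\}_{e\in\mathcal{G}^1,A\in\mathcal{G}^0}$ with the restricted maps $f_e:B_{r(e)}\cap[p]\to L_e\cap[p]$. *)

theory Defs
  imports "HOL-Algebra.Module" "HOL-Library.Countable_Set"
begin

section \<open>Algebras that need not be unital or commutative\<close>

text \<open>As in the library locale \<open>module\<close>, structures over \<open>R\<close> are \<open>module\<close> records. The field
  \<open>one\<close> plays no role for the algebras below, nor do \<open>mult\<close> and \<open>one\<close> for modules.\<close>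

locale nu_algebra = module R A for R (structure) and A (structure) +
  assumes nu_m_closed: "\<lbrakk>x \<in> carrier A; y \<in> carrier A\<rbrakk> \<Longrightarrow> x \<otimes>\<^bsub>A\<^esub> y \<in> carrier A"
    and nu_m_assoc: "\<lbrakk>x \<in> carrier A; y \<in> carrier A; z \<in> carrier A\<rbrakk> \<Longrightarrow>
      (x \<otimes>\<^bsub>A\<^esub> y) \<otimes>\<^bsub>A\<^esub> z = x \<otimes>\<^bsub>A\<^esub> (y \<otimes>\<^bsub>A\<^esub> z)"
    and nu_l_distr: "\<lbrakk>x \<in> carrier A; y \<in> carrier A; z \<in> carrier A\<rbrakk> \<Longrightarrow>
      (x \<oplus>\<^bsub>A\<^esub> y) \<otimes>\<^bsub>A\<^esub> z = (x \<otimes>\<^bsub>A\<^esub> z) \<oplus>\<^bsub>A\<^esub> (y \<otimes>\<^bsub>A\<^esub> z)"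
    and nu_r_distr: "\<lbrakk>x \<in> carrier A; y \<in> carrier A; z \<in> carrier A\<rbrakk> \<Longrightarrow>
      x \<otimes>\<^bsub>A\<^esub> (y \<oplus>\<^bsub>A\<^esub> z) = (x \<otimes>\<^bsub>A\<^esub> y) \<oplus>\<^bsub>A\<^esub> (x \<otimes>\<^bsub>A\<^esub> z)"
    and nu_smult_l: "\<lbrakk>c \<in> carrier R; x \<in> carrier A; y \<in> carrier A\<rbrakk> \<Longrightarrow>
      (c \<odot>\<^bsub>A\<^esub> x) \<otimes>\<^bsub>A\<^esub> y = c \<odot>\<^bsub>A\<^esub> (x \<otimes>\<^bsub>A\<^esub> y)"
    and nu_smult_r: "\<lbrakk>c \<in> carrier R; x \<in> carrier A; y \<in> carrier A\<rbrakk> \<Longrightarrow>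
      x \<otimes>\<^bsub>A\<^esub> (c \<odot>\<^bsub>A\<^esub> y) = c \<odot>\<^bsub>A\<^esub> (x \<otimes>\<^bsub>A\<^esub> y)"

definition nu_algebra_hom ::
  "('k, 'm) ring_scheme \<Rightarrow> ('k, 'a, 'n) module_scheme \<Rightarrow> ('k, 'b, 'o) module_scheme \<Rightarrow> ('a \<Rightarrow> 'b) set"
  where "nu_algebra_hom R A B = {h \<in> carrier A \<rightarrow> carrier B.
    (\<forall>x \<in> carrier A. \<forall>y \<in> carrier A. h (x \<oplus>\<^bsub>A\<^esub> y) = h x \<oplus>\<^bsub>B\<^esub> h y \<and> h (x \<otimes>\<^bsub>A\<^esub> y) = h x \<otimes>\<^bsub>B\<^esub> h y) \<and>
    (\<forall>c \<in> carrier R. \<forall>x \<in> carrier A. h (c \<odot>\<^bsub>A\<^esub> x) = c \<odot>\<^bsub>B\<^esub> h x)}"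

definition linear_endos :: "('k, 'm) ring_scheme \<Rightarrow> ('k, 'a, 'n) module_scheme \<Rightarrow> ('a \<Rightarrow> 'a) set"
  where "linear_endos R M = {f \<in> carrier M \<rightarrow>\<^sub>E carrier M.
    (\<forall>x \<in> carrier M. \<forall>y \<in> carrier M. f (x \<oplus>\<^bsub>M\<^esub> y) = f x \<oplus>\<^bsub>M\<^esub> f y) \<and>
    (\<forall>c \<in> carrier R. \<forall>x \<in> carrier M. f (c \<odot>\<^bsub>M\<^esub> x) = c \<odot>\<^bsub>M\<^esub> f x)}"

definition End_algebra :: "('k, 'm) ring_scheme \<Rightarrow> ('k, 'a, 'n) module_scheme \<Rightarrow> ('k, 'a \<Rightarrow> 'a) module"
  where "End_algebra R M =
    \<lparr>carrier = linear_endos R M,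
     mult = compose (carrier M),
     one = (\<lambda>x\<in>carrier M. x),
     zero = (\<lambda>x\<in>carrier M. \<zero>\<^bsub>M\<^esub>),
     add = (\<lambda>f g. \<lambda>x\<in>carrier M. f x \<oplus>\<^bsub>M\<^esub> g x),
     smult = (\<lambda>c f. \<lambda>x\<in>carrier M. c \<odot>\<^bsub>M\<^esub> f x)\<rparr>"

definition representation ::
  "('k, 'm) ring_scheme \<Rightarrow> ('k, 'a, 'n) module_scheme \<Rightarrow> ('k, 'b, 'o) module_scheme \<Rightarrow> ('a \<Rightarrow> 'b \<Rightarrow> 'b) \<Rightarrow> bool"
  where "representation R A M \<psi> \<longleftrightarrow> module R M \<and> \<psi> \<in> nu_algebra_hom R A (End_algebra R M)"

definition irreducible_representation ::
  "('k, 'm) ring_scheme \<Rightarrow> ('k, 'a, 'n) module_scheme \<Rightarrow> ('k, 'b, 'o) module_scheme \<Rightarrow> ('a \<Rightarrow> 'b \<Rightarrow> 'b) \<Rightarrow> bool"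
  where "irreducible_representation R A M \<psi> \<longleftrightarrow>
    representation R A M \<psi> \<and> carrier M \<noteq> {\<zero>\<^bsub>M\<^esub>} \<and>
    (\<forall>N. submodule N R M \<and> (\<forall>a \<in> carrier A. \<forall>x \<in> N. \<psi> a x \<in> N) \<longrightarrow>
      N = {\<zero>\<^bsub>M\<^esub>} \<or> N = carrier M)"


lemma End_nu_algebra:
  assumes M: "module R M"
  shows "nu_algebra R (End_algebra R M)"
proof -
  interpret module R M by (rule M)
  let ?E = "End_algebra R M"
  have ext: "f = g" if "f \<in> carrier ?E" "g \<in> carrier ?E" "\<And>x. x \<in> carrier M \<Longrightarrow> f x = g x" for f g
    using that by (auto simp: End_algebra_def linear_endos_def intro: PiE_ext)
  have c: "f x \<in> carrier M" if "f \<in> carrier ?E" "x \<in> carrier M" for f x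
    using that by (auto simp: End_algebra_def linear_endos_def)
  have la: "f (x \<oplus>\<^bsub>M\<^esub> y) = f x \<oplus>\<^bsub>M\<^esub> f y" if "f \<in> carrier ?E" "x \<in> carrier M" "y \<in> carrier M" for f x y
    using that by (auto simp: End_algebra_def linear_endos_def)
  have ls: "f (a \<odot>\<^bsub>M\<^esub> x) = a \<odot>\<^bsub>M\<^esub> f x" if "f \<in> carrier ?E" "a \<in> carrier R" "x \<in> carrier M" for f x a
    using that by (auto simp: End_algebra_def linear_endos_def)
  have I: "f \<in> carrier ?E" if "f \<in> extensional (carrier M)" "\<And>x. x \<in> carrier M \<Longrightarrow> f x \<in> carrier M"
    "\<And>x y. \<lbrakk>x \<in> carrier M; y \<in> carrier M\<rbrakk> \<Longrightarrow> f (x \<oplus>\<^bsub>M\<^esub> y) = f x \<oplus>\<^bsub>M\<^esub> f y"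
    "\<And>a x. \<lbrakk>a \<in> carrier R; x \<in> carrier M\<rbrakk> \<Longrightarrow> f (a \<odot>\<^bsub>M\<^esub> x) = a \<odot>\<^bsub>M\<^esub> f x" for f
    using that by (auto simp: End_algebra_def linear_endos_def PiE_def)
  have ap: "(f \<oplus>\<^bsub>?E\<^esub> g) x = f x \<oplus>\<^bsub>M\<^esub> g x" "(f \<otimes>\<^bsub>?E\<^esub> g) x = f (g x)" "(a \<odot>\<^bsub>?E\<^esub> f) x = a \<odot>\<^bsub>M\<^esub> f x"
    "\<zero>\<^bsub>?E\<^esub> x = \<zero>\<^bsub>M\<^esub>" if "x \<in> carrier M" for f g a x
    using that by (auto simp: End_algebra_def compose_def)
  have ex: "f \<oplus>\<^bsub>?E\<^esub> g \<in> extensional (carrier M)" "f \<otimes>\<^bsub>?E\<^esub> g \<in> extensional (carrier M)"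
    "a \<odot>\<^bsub>?E\<^esub> f \<in> extensional (carrier M)" "\<zero>\<^bsub>?E\<^esub> \<in> extensional (carrier M)" for f g a
    by (auto simp: End_algebra_def compose_def)
  have addc: "f \<oplus>\<^bsub>?E\<^esub> g \<in> carrier ?E" if "f \<in> carrier ?E" "g \<in> carrier ?E" for f g
    using that by (intro I ex) (simp_all add: ap c la ls M.a_ac smult_r_distr)
  have mulc: "f \<otimes>\<^bsub>?E\<^esub> g \<in> carrier ?E" if "f \<in> carrier ?E" "g \<in> carrier ?E" for f g
    using that by (intro I ex) (simp_all add: ap c la ls)
  have smc: "a \<odot>\<^bsub>?E\<^esub> f \<in> carrier ?E" if "a \<in> carrier R" "f \<in> carrier ?E" for f a
    using that by (intro I ex)
      (simp_all add: ap c la ls smult_r_distr smult_assoc1[symmetric] R.m_comm)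
  have zc: "\<zero>\<^bsub>?E\<^esub> \<in> carrier ?E"
    by (intro I ex) (simp_all add: ap)
  have neg: "(\<ominus>\<^bsub>R\<^esub> \<one>\<^bsub>R\<^esub>) \<odot>\<^bsub>?E\<^esub> f \<oplus>\<^bsub>?E\<^esub> f = \<zero>\<^bsub>?E\<^esub>" if "f \<in> carrier ?E" for f
    using that by (intro ext addc smc zc) (simp_all add: ap c smult_l_minus M.l_neg)
  have ag: "abelian_group ?E"
  proof (rule abelian_groupI)
    show "\<exists>g\<in>carrier ?E. g \<oplus>\<^bsub>?E\<^esub> f = \<zero>\<^bsub>?E\<^esub>" if "f \<in> carrier ?E" for f
      using neg[OF that] smc[OF _ that, of "\<ominus>\<^bsub>R\<^esub> \<one>\<^bsub>R\<^esub>"] by auto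
  qed (rule ext; simp add: addc zc ap c M.a_ac | simp add: addc zc)+
  have "module R ?E"
    by (rule moduleI[OF R.is_cring ag])
       (rule ext; simp add: addc smc ap c smult_l_distr smult_r_distr smult_assoc1 | simp add: smc)+
  then show ?thesis
    by (intro nu_algebra.intro nu_algebra_axioms.intro)
       (rule ext; simp add: addc smc mulc ap c la ls | simp add: mulc)+
qed


section \<open>The universal algebra on generators and relations\<close>

datatype ('k, 'g) alg_term =
    TGen 'g
  | TZero
  | TNeg "('k, 'g) alg_term"
  | TAdd "('k, 'g) alg_term" "('k, 'g) alg_term"
  | TMult "('k, 'g) alg_term" "('k, 'g) alg_term"
  | TSmult 'k "('k, 'g) alg_term"

inductive_set alg_terms :: "('k, 'm) ring_scheme \<Rightarrow> 'g set \<Rightarrow> ('k, 'g) alg_term set"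
  for R and S where
  "g \<in> S \<Longrightarrow> TGen g \<in> alg_terms R S"
| "TZero \<in> alg_terms R S"
| "t \<in> alg_terms R S \<Longrightarrow> TNeg t \<in> alg_terms R S"
| "\<lbrakk>t \<in> alg_terms R S; u \<in> alg_terms R S\<rbrakk> \<Longrightarrow> TAdd t u \<in> alg_terms R S"
| "\<lbrakk>t \<in> alg_terms R S; u \<in> alg_terms R S\<rbrakk> \<Longrightarrow> TMult t u \<in> alg_terms R S"
| "\<lbrakk>c \<in> carrier R; t \<in> alg_terms R S\<rbrakk> \<Longrightarrow> TSmult c t \<in> alg_terms R S"

text \<open>The least congruence on terms that contains the given relations and makes the quotient an
  associative \<open>R\<close>-algebra.\<close>

inductive_set alg_cong ::
  "('k, 'm) ring_scheme \<Rightarrow> 'g set \<Rightarrow> (('k, 'g) alg_term \<times> ('k, 'g) alg_term) set \<Rightarrow>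
   (('k, 'g) alg_term \<times> ('k, 'g) alg_term) set"
  for R and S and E where
  rel: "\<lbrakk>(t, u) \<in> E; t \<in> alg_terms R S; u \<in> alg_terms R S\<rbrakk> \<Longrightarrow> (t, u) \<in> alg_cong R S E"
| refl: "t \<in> alg_terms R S \<Longrightarrow> (t, t) \<in> alg_cong R S E"
| sym: "(t, u) \<in> alg_cong R S E \<Longrightarrow> (u, t) \<in> alg_cong R S E"
| trans: "\<lbrakk>(t, u) \<in> alg_cong R S E; (u, v) \<in> alg_cong R S E\<rbrakk> \<Longrightarrow> (t, v) \<in> alg_cong R S E"
| neg_cong: "(t, u) \<in> alg_cong R S E \<Longrightarrow> (TNeg t, TNeg u) \<in> alg_cong R S E"
| add_cong: "\<lbrakk>(t, t') \<in> alg_cong R S E; (u, u') \<in> alg_cong R S E\<rbrakk> \<Longrightarrow>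
    (TAdd t u, TAdd t' u') \<in> alg_cong R S E"
| mult_cong: "\<lbrakk>(t, t') \<in> alg_cong R S E; (u, u') \<in> alg_cong R S E\<rbrakk> \<Longrightarrow>
    (TMult t u, TMult t' u') \<in> alg_cong R S E"
| smult_cong: "\<lbrakk>c \<in> carrier R; (t, u) \<in> alg_cong R S E\<rbrakk> \<Longrightarrow>
    (TSmult c t, TSmult c u) \<in> alg_cong R S E"
| add_assoc: "\<lbrakk>t \<in> alg_terms R S; u \<in> alg_terms R S; v \<in> alg_terms R S\<rbrakk> \<Longrightarrow>
    (TAdd (TAdd t u) v, TAdd t (TAdd u v)) \<in> alg_cong R S E"
| add_comm: "\<lbrakk>t \<in> alg_terms R S; u \<in> alg_terms R S\<rbrakk> \<Longrightarrow>
    (TAdd t u, TAdd u t) \<in> alg_cong R S E"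
| add_zero: "t \<in> alg_terms R S \<Longrightarrow> (TAdd TZero t, t) \<in> alg_cong R S E"
| add_neg: "t \<in> alg_terms R S \<Longrightarrow> (TAdd (TNeg t) t, TZero) \<in> alg_cong R S E"
| mult_assoc: "\<lbrakk>t \<in> alg_terms R S; u \<in> alg_terms R S; v \<in> alg_terms R S\<rbrakk> \<Longrightarrow>
    (TMult (TMult t u) v, TMult t (TMult u v)) \<in> alg_cong R S E"
| l_distr: "\<lbrakk>t \<in> alg_terms R S; u \<in> alg_terms R S; v \<in> alg_terms R S\<rbrakk> \<Longrightarrow>
    (TMult (TAdd t u) v, TAdd (TMult t v) (TMult u v)) \<in> alg_cong R S E"
| r_distr: "\<lbrakk>t \<in> alg_terms R S; u \<in> alg_terms R S; v \<in> alg_terms R S\<rbrakk> \<Longrightarrow>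
    (TMult t (TAdd u v), TAdd (TMult t u) (TMult t v)) \<in> alg_cong R S E"
| smult_l_distr: "\<lbrakk>c \<in> carrier R; d \<in> carrier R; t \<in> alg_terms R S\<rbrakk> \<Longrightarrow>
    (TSmult (c \<oplus>\<^bsub>R\<^esub> d) t, TAdd (TSmult c t) (TSmult d t)) \<in> alg_cong R S E"
| smult_r_distr: "\<lbrakk>c \<in> carrier R; t \<in> alg_terms R S; u \<in> alg_terms R S\<rbrakk> \<Longrightarrow>
    (TSmult c (TAdd t u), TAdd (TSmult c t) (TSmult c u)) \<in> alg_cong R S E"
| smult_assoc: "\<lbrakk>c \<in> carrier R; d \<in> carrier R; t \<in> alg_terms R S\<rbrakk> \<Longrightarrow>
    (TSmult (c \<otimes>\<^bsub>R\<^esub> d) t, TSmult c (TSmult d t)) \<in> alg_cong R S E"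
| smult_one: "t \<in> alg_terms R S \<Longrightarrow> (TSmult \<one>\<^bsub>R\<^esub> t, t) \<in> alg_cong R S E"
| smult_mult_l: "\<lbrakk>c \<in> carrier R; t \<in> alg_terms R S; u \<in> alg_terms R S\<rbrakk> \<Longrightarrow>
    (TMult (TSmult c t) u, TSmult c (TMult t u)) \<in> alg_cong R S E"
| smult_mult_r: "\<lbrakk>c \<in> carrier R; t \<in> alg_terms R S; u \<in> alg_terms R S\<rbrakk> \<Longrightarrow>
    (TMult t (TSmult c u), TSmult c (TMult t u)) \<in> alg_cong R S E"

definition presented_algebra ::
  "('k, 'm) ring_scheme \<Rightarrow> 'g set \<Rightarrow> (('k, 'g) alg_term \<times> ('k, 'g) alg_term) set \<Rightarrow>
   ('k, ('k, 'g) alg_term set) module"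
  where "presented_algebra R S E =
    \<lparr>carrier = alg_terms R S // alg_cong R S E,
     mult = (\<lambda>C D. \<Union>t\<in>C. \<Union>u\<in>D. alg_cong R S E `` {TMult t u}),
     one = undefined,
     zero = alg_cong R S E `` {TZero},
     add = (\<lambda>C D. \<Union>t\<in>C. \<Union>u\<in>D. alg_cong R S E `` {TAdd t u}),
     smult = (\<lambda>c C. \<Union>t\<in>C. alg_cong R S E `` {TSmult c t})\<rparr>"

primrec alg_eval :: "('k, 'b, 'o) module_scheme \<Rightarrow> ('g \<Rightarrow> 'b) \<Rightarrow> ('k, 'g) alg_term \<Rightarrow> 'b" where
  "alg_eval B h (TGen g) = h g"
| "alg_eval B h TZero = \<zero>\<^bsub>B\<^esub>"
| "alg_eval B h (TNeg t) = \<ominus>\<^bsub>B\<^esub> alg_eval B h t"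
| "alg_eval B h (TAdd t u) = alg_eval B h t \<oplus>\<^bsub>B\<^esub> alg_eval B h u"
| "alg_eval B h (TMult t u) = alg_eval B h t \<otimes>\<^bsub>B\<^esub> alg_eval B h u"
| "alg_eval B h (TSmult c t) = c \<odot>\<^bsub>B\<^esub> alg_eval B h t"

text \<open>The homomorphism out of a presented algebra that extends \<open>h\<close>; it is well defined when the
  values of \<open>h\<close> satisfy the relations, see \<open>presented_algebra_lift\<close> below.\<close>

definition presented_lift ::
  "('k, 'b, 'o) module_scheme \<Rightarrow> ('g \<Rightarrow> 'b) \<Rightarrow> ('k, 'g) alg_term set \<Rightarrow> 'b"
  where "presented_lift B h C = the_elem (alg_eval B h ` C)"


text \<open>The presented algebra is an algebra and has the universal property.\<close>

lemma alg_cong_terms: "(t, u) \<in> alg_cong R S E \<Longrightarrow> t \<in> alg_terms R S \<and> u \<in> alg_terms R S"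
  if "cring R"
proof (induction rule: alg_cong.induct)
  case (smult_l_distr c d t)
  then show ?case using that by (auto intro!: alg_terms.intros simp: cring.cring_simprules)
next
  case (smult_assoc c d t)
  then show ?case using that by (auto intro!: alg_terms.intros simp: cring.cring_simprules)
next
  case (smult_one t)
  then show ?case using that by (auto intro!: alg_terms.intros simp: cring.cring_simprules)
qed (auto intro: alg_terms.intros)

lemma equiv_alg_cong:
  assumes "cring R"
  shows "equiv (alg_terms R S) (alg_cong R S E)"
proof (rule equivI)
  show "refl_on (alg_terms R S) (alg_cong R S E)"
    by (auto simp: refl_on_def intro: alg_cong.refl)
  show "sym (alg_cong R S E)" by (auto simp: sym_def intro: alg_cong.sym)
  show "trans (alg_cong R S E)" unfolding trans_def by (blast intro: alg_cong.trans)
  show "alg_cong R S E \<subseteq> alg_terms R S \<times> alg_terms R S" using alg_cong_terms[OF assms] by auto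
qed

lemma presented_add_class:
  assumes "cring R" "t \<in> alg_terms R S" "u \<in> alg_terms R S"
  shows "alg_cong R S E `` {t} \<oplus>\<^bsub>presented_algebra R S E\<^esub> alg_cong R S E `` {u}
    = alg_cong R S E `` {TAdd t u}"
proof -
  note eq = equiv_alg_cong[OF assms(1), of S E]
  have "congruent2 (alg_cong R S E) (alg_cong R S E) (\<lambda>t u. alg_cong R S E `` {TAdd t u})"
    by (intro congruent2I' equiv_class_eq[OF eq] alg_cong.add_cong)
  then show ?thesis
    using UN_equiv_class2[OF eq eq _ assms(2,3)] by (simp add: presented_algebra_def)
qed

lemma presented_mult_class:
  assumes "cring R" "t \<in> alg_terms R S" "u \<in> alg_terms R S"
  shows "alg_cong R S E `` {t} \<otimes>\<^bsub>presented_algebra R S E\<^esub> alg_cong R S E `` {u}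
    = alg_cong R S E `` {TMult t u}"
proof -
  note eq = equiv_alg_cong[OF assms(1), of S E]
  have "congruent2 (alg_cong R S E) (alg_cong R S E) (\<lambda>t u. alg_cong R S E `` {TMult t u})"
    by (intro congruent2I' equiv_class_eq[OF eq] alg_cong.mult_cong)
  then show ?thesis
    using UN_equiv_class2[OF eq eq _ assms(2,3)] by (simp add: presented_algebra_def)
qed

lemma presented_smult_class:
  assumes "cring R" "c \<in> carrier R" "t \<in> alg_terms R S"
  shows "c \<odot>\<^bsub>presented_algebra R S E\<^esub> alg_cong R S E `` {t} = alg_cong R S E `` {TSmult c t}"
proof -
  note eq = equiv_alg_cong[OF assms(1), of S E]
  have "congruent (alg_cong R S E) (\<lambda>t. alg_cong R S E `` {TSmult c t})"
    by (intro congruentI equiv_class_eq[OF eq] alg_cong.smult_cong assms(2))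
  then show ?thesis
    using UN_equiv_class[OF eq _ assms(3)] by (simp add: presented_algebra_def)
qed

lemma presented_zero_class:
  "\<zero>\<^bsub>presented_algebra R S E\<^esub> = alg_cong R S E `` {TZero}"
  by (simp add: presented_algebra_def)

lemma presented_carrierI:
  "t \<in> alg_terms R S \<Longrightarrow> alg_cong R S E `` {t} \<in> carrier (presented_algebra R S E)"
  by (simp add: presented_algebra_def quotientI)

lemma presented_carrierE:
  assumes "C \<in> carrier (presented_algebra R S E)"
  obtains t where "t \<in> alg_terms R S" "C = alg_cong R S E `` {t}"
  using assms by (auto simp: presented_algebra_def elim: quotientE)

lemma presented_nu_algebra:
  assumes R: "cring R"
  shows "nu_algebra R (presented_algebra R S E)"
proof -
  let ?P = "presented_algebra R S E"
  interpret R: cring R by (rule R)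
  note eq = equiv_alg_cong[OF R, of S E]
  note cl = presented_add_class[OF R] presented_mult_class[OF R] presented_smult_class[OF R]
    presented_zero_class
  note cI = presented_carrierI
  note tI = alg_terms.intros
  note eqI = equiv_class_eq[OF eq]
  have ag: "abelian_group ?P"
  proof (rule abelian_groupI)
    fix x y assume "x \<in> carrier ?P" "y \<in> carrier ?P"
    then show "x \<oplus>\<^bsub>?P\<^esub> y \<in> carrier ?P"
      by (elim presented_carrierE) (simp add: cl cI tI)
  next
    show "\<zero>\<^bsub>?P\<^esub> \<in> carrier ?P" by (simp add: cl cI tI)
  next
    fix x y z assume "x \<in> carrier ?P" "y \<in> carrier ?P" "z \<in> carrier ?P"
    then show "x \<oplus>\<^bsub>?P\<^esub> y \<oplus>\<^bsub>?P\<^esub> z = x \<oplus>\<^bsub>?P\<^esub> (y \<oplus>\<^bsub>?P\<^esub> z)"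
      by (elim presented_carrierE) (auto simp add: cl tI intro!: eqI alg_cong.add_assoc)
  next
    fix x y assume "x \<in> carrier ?P" "y \<in> carrier ?P"
    then show "x \<oplus>\<^bsub>?P\<^esub> y = y \<oplus>\<^bsub>?P\<^esub> x"
      by (elim presented_carrierE) (auto simp add: cl tI intro!: eqI alg_cong.add_comm)
  next
    fix x assume x: "x \<in> carrier ?P"
    then show "\<zero>\<^bsub>?P\<^esub> \<oplus>\<^bsub>?P\<^esub> x = x"
      by (elim presented_carrierE) (auto simp add: cl tI intro!: eqI alg_cong.add_zero)
    from x obtain t where t: "t \<in> alg_terms R S" "x = alg_cong R S E `` {t}"
      by (rule presented_carrierE)
    have "alg_cong R S E `` {TNeg t} \<oplus>\<^bsub>?P\<^esub> x = \<zero>\<^bsub>?P\<^esub>"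
      using t by (auto simp add: cl tI intro!: eqI alg_cong.add_neg)
    then show "\<exists>y\<in>carrier ?P. y \<oplus>\<^bsub>?P\<^esub> x = \<zero>\<^bsub>?P\<^esub>" using t by (blast intro: cI tI)
  qed
  note ce = eqI[OF alg_cong.smult_l_distr] eqI[OF alg_cong.smult_r_distr]
    eqI[OF alg_cong.smult_assoc] eqI[OF alg_cong.smult_one] eqI[OF alg_cong.mult_assoc]
    eqI[OF alg_cong.l_distr] eqI[OF alg_cong.r_distr] eqI[OF alg_cong.smult_mult_l]
    eqI[OF alg_cong.smult_mult_r]
  have "module R ?P"
    by (rule moduleI[OF R ag]; elim presented_carrierE) (simp_all add: cl cI tI ce)
  then show ?thesis
    by (intro nu_algebra.intro nu_algebra_axioms.intro; (elim presented_carrierE)?)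
       (simp_all add: cl cI tI ce)
qed

lemma alg_eval_closed:
  assumes B: "nu_algebra R B" and h: "h \<in> S \<rightarrow> carrier B" and t: "t \<in> alg_terms R S"
  shows "alg_eval B h t \<in> carrier B"
proof -
  interpret nu_algebra R B by (rule B)
  show ?thesis using t h by induction (auto intro: nu_m_closed)
qed

lemma alg_eval_cong:
  assumes B: "nu_algebra R B" and h: "h \<in> S \<rightarrow> carrier B"
    and E: "\<And>t u. (t, u) \<in> E \<Longrightarrow> alg_eval B h t = alg_eval B h u"
    and tu: "(t, u) \<in> alg_cong R S E"
  shows "alg_eval B h t = alg_eval B h u"
proof -
  interpret nu_algebra R B by (rule B)
  note cl = alg_eval_closed[OF B h]
  show ?thesis using tu
    by induction (use E in \<open>auto simp: cl M.a_ac M.l_neg M.r_neg nu_m_assoc nu_l_distr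
      nu_r_distr smult_l_distr smult_r_distr smult_assoc1 nu_smult_l nu_smult_r\<close>)
qed

lemma presented_lift_class:
  assumes B: "nu_algebra R B" and h: "h \<in> S \<rightarrow> carrier B"
    and E: "\<And>t u. (t, u) \<in> E \<Longrightarrow> alg_eval B h t = alg_eval B h u"
    and t: "t \<in> alg_terms R S"
  shows "presented_lift B h (alg_cong R S E `` {t}) = alg_eval B h t"
proof -
  have "alg_eval B h ` (alg_cong R S E `` {t}) = {alg_eval B h t}"
    using alg_eval_cong[OF B h E] alg_cong.refl[OF t] by (force simp: image_iff)
  then show ?thesis by (simp add: presented_lift_def)
qed

lemma presented_algebra_lift:
  assumes B: "nu_algebra R B" and h: "h \<in> S \<rightarrow> carrier B"
    and E: "\<And>t u. (t, u) \<in> E \<Longrightarrow> alg_eval B h t = alg_eval B h u"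
  shows "presented_lift B h \<in> nu_algebra_hom R (presented_algebra R S E) B"
    and "g \<in> S \<Longrightarrow> presented_lift B h (alg_cong R S E `` {TGen g}) = h g"
proof -
  interpret nu_algebra R B by (rule B)
  have R: "cring R" by (rule R.is_cring)
  note l = presented_lift_class[OF B h E]
  note cl = presented_add_class[OF R] presented_mult_class[OF R] presented_smult_class[OF R]
    alg_terms.intros l alg_eval_closed[OF B h]
  show "presented_lift B h \<in> nu_algebra_hom R (presented_algebra R S E) B"
    unfolding nu_algebra_hom_def by (auto elim!: presented_carrierE simp: cl)
  show "g \<in> S \<Longrightarrow> presented_lift B h (alg_cong R S E `` {TGen g}) = h g"
    by (simp add: l alg_terms.intros)
qed

lemma presented_algebra_hom_unique:
  assumes B: "nu_algebra R B"
    and f: "f \<in> nu_algebra_hom R (presented_algebra R S E) B"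
    and f': "f' \<in> nu_algebra_hom R (presented_algebra R S E) B"
    and gens: "\<And>g. g \<in> S \<Longrightarrow> f (alg_cong R S E `` {TGen g}) = f' (alg_cong R S E `` {TGen g})"
    and C: "C \<in> carrier (presented_algebra R S E)"
  shows "f C = f' C"
proof -
  let ?P = "presented_algebra R S E"
  interpret B: nu_algebra R B by (rule B)
  have R: "cring R" by (rule B.R.is_cring)
  interpret P: nu_algebra R ?P by (rule presented_nu_algebra[OF R])
  note cl = presented_add_class[OF R, symmetric] presented_mult_class[OF R, symmetric]
    presented_smult_class[OF R, symmetric]
  note cI = presented_carrierI[where R = R and S = S and E = E]
  have zero: "k \<zero>\<^bsub>?P\<^esub> = \<zero>\<^bsub>B\<^esub>" if k: "k \<in> nu_algebra_hom R ?P B" for k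
  proof -
    have "k (\<zero>\<^bsub>R\<^esub> \<odot>\<^bsub>?P\<^esub> \<zero>\<^bsub>?P\<^esub>) = \<zero>\<^bsub>R\<^esub> \<odot>\<^bsub>B\<^esub> k \<zero>\<^bsub>?P\<^esub>"
      using k unfolding nu_algebra_hom_def by blast
    moreover have "k \<zero>\<^bsub>?P\<^esub> \<in> carrier B" using k unfolding nu_algebra_hom_def by blast
    ultimately show ?thesis by simp
  qed
  have neg: "alg_cong R S E `` {TNeg t} = (\<ominus>\<^bsub>R\<^esub> \<one>\<^bsub>R\<^esub>) \<odot>\<^bsub>?P\<^esub> (alg_cong R S E `` {t})"
    if t: "t \<in> alg_terms R S" for t
  proof -
    have "alg_cong R S E `` {TNeg t} \<oplus>\<^bsub>?P\<^esub> alg_cong R S E `` {t} = \<zero>\<^bsub>?P\<^esub>"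
      using t by (auto simp add: presented_add_class[OF R] presented_zero_class alg_terms.intros
          intro!: equiv_class_eq[OF equiv_alg_cong[OF R]] alg_cong.add_neg)
    then have "alg_cong R S E `` {TNeg t} = \<ominus>\<^bsub>?P\<^esub> (alg_cong R S E `` {t})"
      using t cI[of "TNeg t"] cI[of t] by (simp add: P.M.minus_equality[symmetric] alg_terms.intros)
    then show ?thesis using cI[OF t] by (simp add: P.smult_l_minus)
  qed
  have "f (alg_cong R S E `` {t}) = f' (alg_cong R S E `` {t})" if "t \<in> alg_terms R S" for t
    using that
  proof induction
    case 1
    then show ?case by (rule gens)
  next
    case 2
    then show ?case using zero[OF f] zero[OF f'] by (simp add: presented_zero_class)
  next
    case (3 t)
    then show ?case using f f' cI[of t] by (simp add: neg nu_algebra_hom_def)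
  next
    case (4 t u)
    then show ?case using f f' cI[of t] cI[of u] by (simp add: cl nu_algebra_hom_def)
  next
    case (5 t u)
    then show ?case using f f' cI[of t] cI[of u] by (simp add: cl nu_algebra_hom_def)
  next
    case (6 c t)
    then show ?case using f f' cI[of t] by (simp add: cl nu_algebra_hom_def)
  qed
  with C show ?thesis by (blast elim: presented_carrierE)
qed


section \<open>Ultragraphs and their Leavitt path algebras\<close>

record ('v, 'e) ultragraph =
  verts :: "'v set"
  edges :: "'e set"
  src :: "'e \<Rightarrow> 'v"
  rng :: "'e \<Rightarrow> 'v set"

locale ultragraph =
  fixes G :: "('v, 'e) ultragraph"
  assumes countable_verts: "countable (verts G)"
    and countable_edges: "countable (edges G)"
    and src_in: "e \<in> edges G \<Longrightarrow> src G e \<in> verts G"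
    and rng_sub: "e \<in> edges G \<Longrightarrow> rng G e \<subseteq> verts G"
    and rng_ne: "e \<in> edges G \<Longrightarrow> rng G e \<noteq> {}"

definition out_edges :: "('v, 'e) ultragraph \<Rightarrow> 'v \<Rightarrow> 'e set"
  where "out_edges G v = {e \<in> edges G. src G e = v}"

definition sinks :: "('v, 'e) ultragraph \<Rightarrow> 'v set"
  where "sinks G = {v \<in> verts G. out_edges G v = {}}"

text \<open>The family of sets of vertices written \<open>\<G>\<^sup>0\<close>. Finite unions include the empty union, so the
  empty set always belongs to it.\<close>

inductive_set vertex_sets :: "('v, 'e) ultragraph \<Rightarrow> 'v set set" for G where
  singleton: "v \<in> verts G \<Longrightarrow> {v} \<in> vertex_sets G"
| range: "e \<in> edges G \<Longrightarrow> rng G e \<in> vertex_sets G"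
| empty: "{} \<in> vertex_sets G"
| union: "\<lbrakk>A \<in> vertex_sets G; B \<in> vertex_sets G\<rbrakk> \<Longrightarrow> A \<union> B \<in> vertex_sets G"
| inter: "\<lbrakk>A \<in> vertex_sets G; B \<in> vertex_sets G\<rbrakk> \<Longrightarrow> A \<inter> B \<in> vertex_sets G"

datatype ('v, 'e) leavitt_gen = Edge 'e | Ghost 'e | Proj "'v set"

definition leavitt_gens :: "('v, 'e) ultragraph \<Rightarrow> ('v, 'e) leavitt_gen set"
  where "leavitt_gens G = Edge ` edges G \<union> Ghost ` edges G \<union> Proj ` vertex_sets G"

abbreviation tS :: "'e \<Rightarrow> ('k, ('v, 'e) leavitt_gen) alg_term" where "tS e \<equiv> TGen (Edge e)"
abbreviation tG :: "'e \<Rightarrow> ('k, ('v, 'e) leavitt_gen) alg_term" where "tG e \<equiv> TGen (Ghost e)"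
abbreviation tP :: "'v set \<Rightarrow> ('k, ('v, 'e) leavitt_gen) alg_term" where "tP A \<equiv> TGen (Proj A)"

text \<open>In \<open>vertex_sum\<close> the list \<open>es\<close> enumerates the edges emitted by \<open>v\<close>; it exists and is nonempty
  exactly when \<open>v\<close> emits a nonzero finite number of edges.\<close>

inductive_set leavitt_rels ::
  "('v, 'e) ultragraph \<Rightarrow>
   (('k, ('v, 'e) leavitt_gen) alg_term \<times> ('k, ('v, 'e) leavitt_gen) alg_term) set"
  for G where
  proj_empty: "(tP {}, TZero) \<in> leavitt_rels G"
| proj_inter: "\<lbrakk>A \<in> vertex_sets G; B \<in> vertex_sets G\<rbrakk> \<Longrightarrow>
    (TMult (tP A) (tP B), tP (A \<inter> B)) \<in> leavitt_rels G"
| proj_union: "\<lbrakk>A \<in> vertex_sets G; B \<in> vertex_sets G\<rbrakk> \<Longrightarrow>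
    (tP (A \<union> B), TAdd (TAdd (tP A) (tP B)) (TNeg (tP (A \<inter> B)))) \<in> leavitt_rels G"
| src_edge: "e \<in> edges G \<Longrightarrow> (TMult (tP {src G e}) (tS e), tS e) \<in> leavitt_rels G"
| edge_rng: "e \<in> edges G \<Longrightarrow> (TMult (tS e) (tP (rng G e)), tS e) \<in> leavitt_rels G"
| rng_ghost: "e \<in> edges G \<Longrightarrow> (TMult (tP (rng G e)) (tG e), tG e) \<in> leavitt_rels G"
| ghost_src: "e \<in> edges G \<Longrightarrow> (TMult (tG e) (tP {src G e}), tG e) \<in> leavitt_rels G"
| ghost_edge_same: "e \<in> edges G \<Longrightarrow> (TMult (tG e) (tS e), tP (rng G e)) \<in> leavitt_rels G"
| ghost_edge_diff: "\<lbrakk>e \<in> edges G; f \<in> edges G; e \<noteq> f\<rbrakk> \<Longrightarrow>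
    (TMult (tG e) (tS f), TZero) \<in> leavitt_rels G"
| vertex_sum: "\<lbrakk>v \<in> verts G; set es = out_edges G v; distinct es; es \<noteq> []\<rbrakk> \<Longrightarrow>
    (tP {v}, foldr (\<lambda>e. TAdd (TMult (tS e) (tG e))) es TZero) \<in> leavitt_rels G"

definition leavitt_path_algebra ::
  "('k, 'm) ring_scheme \<Rightarrow> ('v, 'e) ultragraph \<Rightarrow> ('k, ('k, ('v, 'e) leavitt_gen) alg_term set) module"
  where "leavitt_path_algebra R G = presented_algebra R (leavitt_gens G) (leavitt_rels G)"

definition leavitt_class ::
  "('k, 'm) ring_scheme \<Rightarrow> ('v, 'e) ultragraph \<Rightarrow> ('v, 'e) leavitt_gen \<Rightarrow>
   ('k, ('v, 'e) leavitt_gen) alg_term set"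
  where "leavitt_class R G g = alg_cong R (leavitt_gens G) (leavitt_rels G) `` {TGen g}"


text \<open>The relations are relations between terms over the generators.\<close>

lemma leavitt_rels_terms:
  assumes "ultragraph G" "cring R"
  shows "leavitt_rels G \<subseteq> alg_terms R (leavitt_gens G) \<times> alg_terms R (leavitt_gens G)"
proof -
  interpret ultragraph G by (rule assms(1))
  have P: "A \<in> vertex_sets G \<Longrightarrow> tP A \<in> alg_terms R (leavitt_gens G)" for A
    by (auto intro!: alg_terms.intros simp: leavitt_gens_def)
  have S: "e \<in> edges G \<Longrightarrow> tS e \<in> alg_terms R (leavitt_gens G)"
    and Gh: "e \<in> edges G \<Longrightarrow> tG e \<in> alg_terms R (leavitt_gens G)" for e
    by (auto intro!: alg_terms.intros simp: leavitt_gens_def)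
  have F: "foldr (\<lambda>e. TAdd (TMult (tS e) (tG e))) es TZero \<in> alg_terms R (leavitt_gens G)"
    if "set es \<subseteq> edges G" for es
    using that by (induction es) (auto intro!: alg_terms.intros(2-5) S Gh)
  have "t \<in> alg_terms R (leavitt_gens G) \<and> u \<in> alg_terms R (leavitt_gens G)"
    if "(t, u) \<in> leavitt_rels G" for t u
    using that
  proof cases
    case (vertex_sum v es)
    then show ?thesis using F[of es] P[of "{v}"] by (auto simp: out_edges_def vertex_sets.singleton)
  qed (auto intro!: alg_terms.intros(2-5) P S Gh src_in intro: vertex_sets.intros)
  then show ?thesis by auto
qed


section \<open>Branching systems and the associated representations\<close>

record ('v, 'e, 'x) branching =
  pts :: "'x set"
  D_set :: "'v set \<Rightarrow> 'x set"
  R_set :: "'e \<Rightarrow> 'x set"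
  g_map :: "'e \<Rightarrow> 'x \<Rightarrow> 'x"

locale branching_system = ultragraph G
  for G :: "('v, 'e) ultragraph" and X :: "('v, 'e, 'x) branching" +
  assumes D_sub: "A \<in> vertex_sets G \<Longrightarrow> D_set X A \<subseteq> pts X"
    and R_sub: "e \<in> edges G \<Longrightarrow> R_set X e \<subseteq> pts X"
    and R_disj: "\<lbrakk>e \<in> edges G; f \<in> edges G; e \<noteq> f\<rbrakk> \<Longrightarrow> R_set X e \<inter> R_set X f = {}"
    and D_empty: "D_set X {} = {}"
    and D_inter: "\<lbrakk>A \<in> vertex_sets G; B \<in> vertex_sets G\<rbrakk> \<Longrightarrow>
      D_set X A \<inter> D_set X B = D_set X (A \<inter> B)"
    and D_union: "\<lbrakk>A \<in> vertex_sets G; B \<in> vertex_sets G\<rbrakk> \<Longrightarrow>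
      D_set X A \<union> D_set X B = D_set X (A \<union> B)"
    and R_sub_D: "e \<in> edges G \<Longrightarrow> R_set X e \<subseteq> D_set X {src G e}"
    and D_finite_emitter: "\<lbrakk>v \<in> verts G; finite (out_edges G v); out_edges G v \<noteq> {}\<rbrakk> \<Longrightarrow>
      D_set X {v} = (\<Union>e\<in>out_edges G v. R_set X e)"
    and g_bij: "e \<in> edges G \<Longrightarrow> bij_betw (g_map X e) (D_set X (rng G e)) (R_set X e)"

locale perfect_branching_system = branching_system G X
  for G :: "('v, 'e) ultragraph" and X :: "('v, 'e, 'x) branching" +
  assumes pts_cover: "pts X = (\<Union>v\<in>verts G. D_set X {v})"
    and D_emitter: "v \<in> verts G - sinks G \<Longrightarrow> D_set X {v} = (\<Union>e\<in>out_edges G v. R_set X e)"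

text \<open>The module \<open>M(X)\<close>: a map \<open>X \<rightarrow> R\<close> of finite support is represented by its extension by zero.\<close>

definition finsupp_maps :: "('k, 'm) ring_scheme \<Rightarrow> 'x set \<Rightarrow> ('k, 'x \<Rightarrow> 'k) module"
  where "finsupp_maps R X =
    \<lparr>carrier = {\<phi>. (\<forall>x. \<phi> x \<in> carrier R) \<and> (\<forall>x. x \<notin> X \<longrightarrow> \<phi> x = \<zero>\<^bsub>R\<^esub>) \<and> finite {x. \<phi> x \<noteq> \<zero>\<^bsub>R\<^esub>}},
     mult = undefined,
     one = undefined,
     zero = (\<lambda>x. \<zero>\<^bsub>R\<^esub>),
     add = (\<lambda>\<phi> \<chi> x. \<phi> x \<oplus>\<^bsub>R\<^esub> \<chi> x),
     smult = (\<lambda>c \<phi> x. c \<otimes>\<^bsub>R\<^esub> \<phi> x)\<rparr>"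

lemma finsupp_module:
  fixes R :: "('a, 'm) ring_scheme" and X :: "'b set"
  assumes "cring R"
  shows "module R (finsupp_maps R X)"
proof -
  interpret R: cring R by (rule assms)
  have a: "finite {x. \<phi> x \<oplus>\<^bsub>R\<^esub> \<chi> x \<noteq> \<zero>\<^bsub>R\<^esub>}"
    if "finite {x. \<phi> x \<noteq> \<zero>\<^bsub>R\<^esub>}" "finite {x. \<chi> x \<noteq> \<zero>\<^bsub>R\<^esub>}" for \<phi> \<chi> :: "'b \<Rightarrow> 'a"
    by (rule finite_subset[OF _ finite_UnI[OF that]]) auto
  have n: "finite {x. \<ominus>\<^bsub>R\<^esub> \<phi> x \<noteq> \<zero>\<^bsub>R\<^esub>}" if "finite {x. \<phi> x \<noteq> \<zero>\<^bsub>R\<^esub>}" for \<phi> :: "'b \<Rightarrow> 'a"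
    by (rule finite_subset[OF _ that]) auto
  have s: "finite {x. c \<otimes>\<^bsub>R\<^esub> \<phi> x \<noteq> \<zero>\<^bsub>R\<^esub>}" if "finite {x. \<phi> x \<noteq> \<zero>\<^bsub>R\<^esub>}" "c \<in> carrier R"
    for \<phi> :: "'b \<Rightarrow> 'a" and c
    by (rule finite_subset[OF _ that(1)]) (use that(2) in auto)
  have ag: "abelian_group (finsupp_maps R X)"
  proof (rule abelian_groupI)
    fix \<phi> assume \<phi>: "\<phi> \<in> carrier (finsupp_maps R X)"
    show "\<exists>\<chi>\<in>carrier (finsupp_maps R X). \<chi> \<oplus>\<^bsub>finsupp_maps R X\<^esub> \<phi> = \<zero>\<^bsub>finsupp_maps R X\<^esub>"
      by (rule bexI[of _ "\<lambda>x. \<ominus>\<^bsub>R\<^esub> \<phi> x"])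
         (use \<phi> in \<open>simp_all add: finsupp_maps_def R.l_neg n\<close>)
  qed (simp_all add: finsupp_maps_def R.a_ac a)
  show ?thesis
    by (rule moduleI[OF assms ag])
       (simp_all add: finsupp_maps_def R.l_distr R.r_distr R.m_assoc s)
qed

primrec gen_action ::
  "('k, 'm) ring_scheme \<Rightarrow> ('v, 'e) ultragraph \<Rightarrow> ('v, 'e, 'x) branching \<Rightarrow>
   ('v, 'e) leavitt_gen \<Rightarrow> ('x \<Rightarrow> 'k) \<Rightarrow> 'x \<Rightarrow> 'k" where
  "gen_action R G X (Proj A) \<phi> = (\<lambda>x. if x \<in> D_set X A then \<phi> x else \<zero>\<^bsub>R\<^esub>)"
| "gen_action R G X (Edge e) \<phi> =
    (\<lambda>x. if x \<in> R_set X e then \<phi> (inv_into (D_set X (rng G e)) (g_map X e) x) else \<zero>\<^bsub>R\<^esub>)"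
| "gen_action R G X (Ghost e) \<phi> =
    (\<lambda>x. if x \<in> D_set X (rng G e) then \<phi> (g_map X e x) else \<zero>\<^bsub>R\<^esub>)"

definition branching_rep ::
  "('k, 'm) ring_scheme \<Rightarrow> ('v, 'e) ultragraph \<Rightarrow> ('v, 'e, 'x) branching \<Rightarrow>
   ('k, ('v, 'e) leavitt_gen) alg_term set \<Rightarrow> ('x \<Rightarrow> 'k) \<Rightarrow> 'x \<Rightarrow> 'k"
  where "branching_rep R G X =
    presented_lift (End_algebra R (finsupp_maps R (pts X)))
      (\<lambda>g. restrict (gen_action R G X g) (carrier (finsupp_maps R (pts X))))"

text \<open>The operators attached to the generators satisfy the defining relations, so \<open>branching_rep\<close>
  is a representation and acts on generators by the expected formulas.\<close>

lemma gen_action_End: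
  assumes X: "branching_system G X" and R: "cring R" and g: "g \<in> leavitt_gens G"
  shows "restrict (gen_action R G X g) (carrier (finsupp_maps R (pts X)))
    \<in> carrier (End_algebra R (finsupp_maps R (pts X)))"
proof -
  interpret branching_system G X by (rule X)
  interpret R: cring R by (rule R)
  let ?M = "finsupp_maps R (pts X)"
  interpret M: module R ?M by (rule finsupp_module[OF R])
  have closed: "gen_action R G X g \<phi> \<in> carrier ?M" if \<phi>: "\<phi> \<in> carrier ?M" for \<phi>
  proof -
    have c: "\<phi> x \<in> carrier R" for x using \<phi> by (simp add: finsupp_maps_def)
    have fin: "finite {x. \<phi> x \<noteq> \<zero>\<^bsub>R\<^esub>}" using \<phi> by (simp add: finsupp_maps_def)
    from g consider A where "A \<in> vertex_sets G" "g = Proj A" | e where "e \<in> edges G" "g = Edge e"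
      | e where "e \<in> edges G" "g = Ghost e" by (auto simp: leavitt_gens_def)
    then show ?thesis
    proof cases
      case 1
      have "finite {x. gen_action R G X g \<phi> x \<noteq> \<zero>\<^bsub>R\<^esub>}"
        by (rule finite_subset[OF _ fin]) (auto simp: 1)
      with 1 D_sub[of A] c show ?thesis by (auto simp: finsupp_maps_def)
    next
      case (2 e)
      let ?i = "inv_into (D_set X (rng G e)) (g_map X e)"
      have "inj_on ?i (R_set X e)"
        using g_bij[OF 2(1)] by (metis bij_betw_imp_inj_on bij_betw_inv_into)
      then have "finite (?i -` {x. \<phi> x \<noteq> \<zero>\<^bsub>R\<^esub>} \<inter> R_set X e)"
        using fin by (rule finite_vimage_IntI[rotated])
      then have "finite {x. gen_action R G X g \<phi> x \<noteq> \<zero>\<^bsub>R\<^esub>}"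
        by (rule rev_finite_subset) (auto simp: 2 split: if_splits)
      with 2 R_sub[of e] c show ?thesis by (auto simp: finsupp_maps_def)
    next
      case (3 e)
      have "inj_on (g_map X e) (D_set X (rng G e))"
        using g_bij[OF 3(1)] by (metis bij_betw_imp_inj_on)
      then have "finite (g_map X e -` {x. \<phi> x \<noteq> \<zero>\<^bsub>R\<^esub>} \<inter> D_set X (rng G e))"
        using fin by (rule finite_vimage_IntI[rotated])
      then have "finite {x. gen_action R G X g \<phi> x \<noteq> \<zero>\<^bsub>R\<^esub>}"
        by (rule rev_finite_subset) (auto simp: 3 split: if_splits)
      with 3 D_sub[OF vertex_sets.range[of e]] c show ?thesis by (auto simp: finsupp_maps_def)
    qed
  qed
  have lin: "gen_action R G X g (\<phi> \<oplus>\<^bsub>?M\<^esub> \<chi>) = gen_action R G X g \<phi> \<oplus>\<^bsub>?M\<^esub> gen_action R G X g \<chi>"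
    "c \<in> carrier R \<Longrightarrow> gen_action R G X g (c \<odot>\<^bsub>?M\<^esub> \<phi>) = c \<odot>\<^bsub>?M\<^esub> gen_action R G X g \<phi>" for \<phi> \<chi> c
    by (cases g; simp add: finsupp_maps_def fun_eq_iff)+
  show ?thesis
    by (simp add: End_algebra_def linear_endos_def closed lin)
qed

lemma gen_action_relations:
  assumes X: "branching_system G X" and R: "cring R" and tu: "(t, u) \<in> leavitt_rels G"
  defines "M \<equiv> finsupp_maps R (pts X)"
  defines "h \<equiv> \<lambda>g. restrict (gen_action R G X g) (carrier M)"
  shows "alg_eval (End_algebra R M) h t = alg_eval (End_algebra R M) h u"
proof -
  interpret branching_system G X by (rule X)
  interpret M: module R M unfolding M_def by (rule finsupp_module[OF R])
  let ?E = "End_algebra R M"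
  interpret E: nu_algebra R ?E by (rule End_nu_algebra[OF M.module_axioms])
  have h: "h \<in> leavitt_gens G \<rightarrow> carrier ?E"
    unfolding h_def M_def using gen_action_End[OF X R] by blast
  have ev: "alg_eval ?E h t \<in> carrier ?E" if "t \<in> alg_terms R (leavitt_gens G)" for t
    by (rule alg_eval_closed[OF E.nu_algebra_axioms h that])
  have tT: "t \<in> alg_terms R (leavitt_gens G)" and uT: "u \<in> alg_terms R (leavitt_gens G)"
    using leavitt_rels_terms[OF ultragraph_axioms R] tu by auto
  have hc: "h g \<phi> \<in> carrier M" if "g \<in> leavitt_gens G" "\<phi> \<in> carrier M" for g \<phi>
    using h that by (auto simp: End_algebra_def linear_endos_def)
  have ap: "(f \<oplus>\<^bsub>?E\<^esub> g) \<phi> = (\<lambda>x. f \<phi> x \<oplus>\<^bsub>R\<^esub> g \<phi> x)" "(f \<otimes>\<^bsub>?E\<^esub> g) \<phi> = f (g \<phi>)"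
    "\<zero>\<^bsub>?E\<^esub> \<phi> = (\<lambda>x. \<zero>\<^bsub>R\<^esub>)" if "\<phi> \<in> carrier M" for f g \<phi>
    using that by (auto simp: End_algebra_def compose_def) (auto simp: M_def finsupp_maps_def)
  have neg: "(\<ominus>\<^bsub>?E\<^esub> f) \<phi> = (\<lambda>x. \<ominus>\<^bsub>R\<^esub> f \<phi> x)" if f: "f \<in> carrier ?E" and \<phi>: "\<phi> \<in> carrier M" for f \<phi>
  proof -
    have "\<ominus>\<^bsub>?E\<^esub> f = (\<ominus>\<^bsub>R\<^esub> \<one>\<^bsub>R\<^esub>) \<odot>\<^bsub>?E\<^esub> f" using f by (simp add: E.smult_l_minus)
    moreover have "f \<phi> \<in> carrier M" using f \<phi> by (auto simp: End_algebra_def linear_endos_def)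
    ultimately show ?thesis using \<phi>
      by (simp add: End_algebra_def) (simp add: M_def finsupp_maps_def M.R.l_minus)
  qed
  have act: "h g \<phi> = gen_action R G X g \<phi>" if "\<phi> \<in> carrier M" for g \<phi>
    using that by (simp add: h_def)
  have ga: "gen_action R G X g \<phi> \<in> carrier M" if "g \<in> leavitt_gens G" "\<phi> \<in> carrier M" for g \<phi>
    using hc[OF that] act[OF that(2)] by simp
  have gP: "A \<in> vertex_sets G \<Longrightarrow> Proj A \<in> leavitt_gens G"
    and gE: "e \<in> edges G \<Longrightarrow> Edge e \<in> leavitt_gens G"
    and gG: "e \<in> edges G \<Longrightarrow> Ghost e \<in> leavitt_gens G" for A e
    by (auto simp: leavitt_gens_def)
  note acts = ap act ga gP gE gG
  have \<phi>R: "\<phi> x \<in> carrier R" if "\<phi> \<in> carrier M" for \<phi> x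
    using that by (simp add: M_def finsupp_maps_def)
  have inv: "inv_into (D_set X (rng G e)) (g_map X e) x \<in> D_set X (rng G e)"
      "g_map X e (inv_into (D_set X (rng G e)) (g_map X e) x) = x"
    if "e \<in> edges G" "x \<in> R_set X e" for e x
    using g_bij[OF that(1)] that(2)
    by (metis bij_betw_imp_surj_on inv_into_into, metis bij_betw_inv_into_right)
  have inv': "inv_into (D_set X (rng G e)) (g_map X e) (g_map X e x) = x" "g_map X e x \<in> R_set X e"
    if "e \<in> edges G" "x \<in> D_set X (rng G e)" for e x
    using g_bij[OF that(1)] that(2) by (metis bij_betw_inv_into_left, metis bij_betwE)
  have "alg_eval ?E h t \<phi> = alg_eval ?E h u \<phi>" if \<phi>: "\<phi> \<in> carrier M" for \<phi>
    using tu
  proof cases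
    case proj_empty
    then show ?thesis using \<phi> by (simp add: ap act D_empty)
  next
    case (proj_inter A B)
    then show ?thesis using \<phi> D_inter[of A B]
      by (simp add: acts del: gen_action.simps) (auto simp: fun_eq_iff)
  next
    case (proj_union A B)
    have "h (Proj (A \<inter> B)) \<in> carrier ?E"
      using h gP proj_union by (auto intro: vertex_sets.inter)
    then show ?thesis using \<phi> proj_union D_inter[of A B, symmetric] D_union[of A B, symmetric]
      by (simp add: acts neg del: gen_action.simps)
         (auto simp: \<phi>R fun_eq_iff M.R.a_assoc M.R.r_neg)
  next
    case (src_edge e)
    then show ?thesis using \<phi> R_sub_D[of e]
      by (simp add: acts del: gen_action.simps) (auto simp: fun_eq_iff)
  next
    case (edge_rng e)
    then show ?thesis using \<phi> inv[of e]
      by (simp add: acts vertex_sets.range del: gen_action.simps) (auto simp: fun_eq_iff)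
  next
    case (rng_ghost e)
    then show ?thesis using \<phi>
      by (simp add: acts del: gen_action.simps) (auto simp: fun_eq_iff)
  next
    case (ghost_src e)
    then have "{src G e} \<in> vertex_sets G" by (simp add: vertex_sets.singleton src_in)
    then show ?thesis using \<phi> R_sub_D[of e] inv'[of e] ghost_src
      by (simp add: acts del: gen_action.simps) (auto simp: fun_eq_iff)
  next
    case (ghost_edge_same e)
    then show ?thesis using \<phi> inv'[of e]
      by (simp add: acts del: gen_action.simps) (auto simp: fun_eq_iff)
  next
    case (ghost_edge_diff e f)
    then show ?thesis using \<phi> inv'[of e] R_disj[of e f]
      by (simp add: acts del: gen_action.simps) (auto simp: fun_eq_iff)
  next
    case (vertex_sum v es)
    have sum: "alg_eval ?E h (foldr (\<lambda>e. TAdd (TMult (tS e) (tG e))) fs TZero) \<phi> =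
      (\<lambda>x. if x \<in> (\<Union>e\<in>set fs. R_set X e) then \<phi> x else \<zero>\<^bsub>R\<^esub>)"
      if "distinct fs" "set fs \<subseteq> edges G" for fs
      using that
    proof (induction fs)
      case Nil
      then show ?case using \<phi> by (simp add: ap)
    next
      case (Cons e fs)
      have e: "h (Edge e) (h (Ghost e) \<phi>) = (\<lambda>x. if x \<in> R_set X e then \<phi> x else \<zero>\<^bsub>R\<^esub>)"
        using Cons.prems inv[of e] \<phi>
        by (simp add: acts del: gen_action.simps) (auto simp: fun_eq_iff)
      have d: "R_set X e \<inter> R_set X f = {}" if "f \<in> set fs" for f
        using Cons.prems that by (intro R_disj) auto
      show ?case using Cons d \<phi> by (auto simp: ap e \<phi>R fun_eq_iff)
    qed
    have "finite (out_edges G v)" "out_edges G v \<noteq> {}"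
      using vertex_sum by (metis List.finite_set, metis set_empty)
    then show ?thesis
      using vertex_sum D_finite_emitter[of v] sum[of es] \<phi> by (auto simp: act out_edges_def)
  qed
  moreover have "carrier ?E \<subseteq> extensional (carrier M)"
    by (auto simp: End_algebra_def linear_endos_def PiE_def)
  ultimately show ?thesis
    using extensionalityI[OF subsetD[OF _ ev[OF tT]] subsetD[OF _ ev[OF uT]]] by blast
qed

lemma branching_rep_representation:
  assumes X: "branching_system G X" and R: "cring R"
  shows "representation R (leavitt_path_algebra R G) (finsupp_maps R (pts X)) (branching_rep R G X)"
proof -
  note M = finsupp_module[OF R]
  note lift = presented_algebra_lift(1)[OF End_nu_algebra[OF M] Pi_I gen_action_relations[OF X R]]
  show ?thesis
    unfolding representation_def branching_rep_def leavitt_path_algebra_def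
    using M lift gen_action_End[OF X R] by blast
qed

lemma branching_rep_gen:
  assumes X: "branching_system G X" and R: "cring R"
    and g: "g \<in> leavitt_gens G" and \<phi>: "\<phi> \<in> carrier (finsupp_maps R (pts X))"
  shows "branching_rep R G X (leavitt_class R G g) \<phi> = gen_action R G X g \<phi>"
proof -
  have "branching_rep R G X (leavitt_class R G g) =
      restrict (gen_action R G X g) (carrier (finsupp_maps R (pts X)))"
    unfolding branching_rep_def leavitt_class_def
    by (rule presented_algebra_lift(2)[OF End_nu_algebra[OF finsupp_module[OF R]] _ _ g])
       (auto intro: gen_action_End[OF X R] gen_action_relations[OF X R])
  with \<phi> show ?thesis by simp
qed

definition branching_morphism ::
  "('v, 'e) ultragraph \<Rightarrow> ('v, 'e, 'x) branching \<Rightarrow> ('v, 'e, 'y) branching \<Rightarrow> ('x \<Rightarrow> 'y) \<Rightarrow> bool"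
  where "branching_morphism G X Y T \<longleftrightarrow>
    T \<in> pts X \<rightarrow> pts Y \<and>
    (\<forall>e \<in> edges G. T ` R_set X e \<subseteq> R_set Y e) \<and>
    (\<forall>A \<in> vertex_sets G. T ` D_set X A \<subseteq> D_set Y A) \<and>
    (\<forall>e \<in> edges G. \<forall>x \<in> D_set X (rng G e). T (g_map X e x) = g_map Y e (T x))"

definition branching_isomorphic ::
  "('v, 'e) ultragraph \<Rightarrow> ('v, 'e, 'x) branching \<Rightarrow> ('v, 'e, 'y) branching \<Rightarrow> bool"
  where "branching_isomorphic G X Y \<longleftrightarrow>
    (\<exists>T U. branching_morphism G X Y T \<and> branching_morphism G Y X U \<and>
      (\<forall>x \<in> pts X. U (T x) = x) \<and> (\<forall>y \<in> pts Y. T (U y) = y))"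


section \<open>Paths\<close>

text \<open>\<open>Fin_path \<alpha> v\<close> is the pair \<open>(\<alpha>, v)\<close>, and \<open>Fin_path [] v\<close> is \<open>(v, v)\<close>.
  \<open>Inf_path f\<close> is the sequence \<open>f 0, f 1, f 2, \<dots>\<close>, so indices are shifted down by one.\<close>

datatype ('v, 'e) path = Fin_path "'e list" 'v | Inf_path "nat \<Rightarrow> 'e"

definition is_edge_path :: "('v, 'e) ultragraph \<Rightarrow> 'e list \<Rightarrow> bool"
  where "is_edge_path G es \<longleftrightarrow> set es \<subseteq> edges G \<and>
    (\<forall>i. Suc i < length es \<longrightarrow> src G (es ! Suc i) \<in> rng G (es ! i))"

definition sink_paths :: "('v, 'e) ultragraph \<Rightarrow> ('v, 'e) path set"
  where "sink_paths G =
    {Fin_path es v | es v. es \<noteq> [] \<and> is_edge_path G es \<and> v \<in> rng G (last es) \<inter> sinks G} \<union>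
    {Fin_path [] v | v. v \<in> sinks G}"

definition infinite_paths :: "('v, 'e) ultragraph \<Rightarrow> ('v, 'e) path set"
  where "infinite_paths G =
    {Inf_path f | f. (\<forall>i. f i \<in> edges G) \<and> (\<forall>i. src G (f (Suc i)) \<in> rng G (f i))}"

definition all_paths :: "('v, 'e) ultragraph \<Rightarrow> ('v, 'e) path set"
  where "all_paths G = sink_paths G \<union> infinite_paths G"

fun path_src :: "('v, 'e) ultragraph \<Rightarrow> ('v, 'e) path \<Rightarrow> 'v" where
  "path_src G (Fin_path [] v) = v"
| "path_src G (Fin_path (e # es) v) = src G e"
| "path_src G (Inf_path f) = src G (f 0)"

fun first_edge :: "('v, 'e) path \<Rightarrow> 'e option" where
  "first_edge (Fin_path [] v) = None"
| "first_edge (Fin_path (e # es) v) = Some e"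
| "first_edge (Inf_path f) = Some (f 0)"

fun path_cons :: "'e \<Rightarrow> ('v, 'e) path \<Rightarrow> ('v, 'e) path" where
  "path_cons e (Fin_path es v) = Fin_path (e # es) v"
| "path_cons e (Inf_path f) = Inf_path (case_nat e f)"

fun tail_equivalent :: "('v, 'e) path \<Rightarrow> ('v, 'e) path \<Rightarrow> bool" where
  "tail_equivalent (Fin_path a v) (Fin_path b w) \<longleftrightarrow> v = w"
| "tail_equivalent (Inf_path f) (Inf_path g) \<longleftrightarrow> (\<exists>i j. \<forall>k. f (i + k) = g (j + k))"
| "tail_equivalent (Fin_path a v) (Inf_path g) \<longleftrightarrow> False"
| "tail_equivalent (Inf_path f) (Fin_path b w) \<longleftrightarrow> False"

definition path_equiv :: "('v, 'e) ultragraph \<Rightarrow> (('v, 'e) path \<times> ('v, 'e) path) set"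
  where "path_equiv G = {(p, q). p \<in> all_paths G \<and> q \<in> all_paths G \<and> tail_equivalent p q}"

lemma tail_equivalent_sym: "tail_equivalent p q \<Longrightarrow> tail_equivalent q p"
  by (cases p; cases q) (auto, metis)

lemma equiv_path_equiv: "equiv (all_paths G) (path_equiv G)"
proof (rule equivI)
  show "path_equiv G \<subseteq> all_paths G \<times> all_paths G" by (auto simp: path_equiv_def)
  have "tail_equivalent p p" for p :: "('a, 'b) path" by (cases p) auto
  then show "refl_on (all_paths G) (path_equiv G)" by (auto simp: refl_on_def path_equiv_def)
  show "sym (path_equiv G)" by (auto simp: sym_def path_equiv_def intro: tail_equivalent_sym)
  have "tail_equivalent p r" if "tail_equivalent p q" "tail_equivalent q r" for p q r :: "('a, 'b) path"
  proof (cases p; cases q; cases r)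
    fix f g h assume pqr: "p = Inf_path f" "q = Inf_path g" "r = Inf_path h"
    with that obtain i j k l where "\<And>n. f (i + n) = g (j + n)" "\<And>n. g (k + n) = h (l + n)" by auto
    then have "f (i + k + n) = h (l + j + n)" for n
      by (metis add.assoc add.commute)
    then show ?thesis using pqr by (auto intro!: exI)
  qed (use that in auto)
  then show "trans (path_equiv G)" unfolding trans_def path_equiv_def by blast
qed

text \<open>The branching system on all paths, cut down to a set \<open>C\<close> of paths; used for equivalence
  classes \<open>C\<close> only.\<close>

definition path_branching ::
  "('v, 'e) ultragraph \<Rightarrow> ('v, 'e) path set \<Rightarrow> ('v, 'e, ('v, 'e) path) branching"
  where "path_branching G C =
    \<lparr>pts = C,
     D_set = (\<lambda>A. {x \<in> all_paths G. path_src G x \<in> A} \<inter> C),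
     R_set = (\<lambda>e. {x \<in> all_paths G. first_edge x = Some e} \<inter> C),
     g_map = path_cons\<rparr>"

text \<open>Equivalence classes are indeed branching systems.\<close>

lemma path_cons_tail: "tail_equivalent x (path_cons e x)"
proof (cases x)
  case (Inf_path f)
  have "\<forall>k. f (0 + k) = case_nat e f (Suc 0 + k)" by simp
  with Inf_path show ?thesis by (simp only: path_cons.simps tail_equivalent.simps) blast
qed simp

lemma path_cons_inj:
  assumes "path_cons e x = path_cons e y"
  shows "x = y"
proof (cases x; cases y)
  fix f g assume fg: "x = Inf_path f" "y = Inf_path g"
  with assms have eq: "case_nat e f = case_nat e g" by simp
  have "f n = g n" for n using fun_cong[OF eq, of "Suc n"] by simp
  with fg show ?thesis by auto
qed (use assms in auto)

lemma path_cons_mem: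
  assumes "e \<in> edges G" "x \<in> all_paths G" "path_src G x \<in> rng G e"
  shows "path_cons e x \<in> all_paths G"
proof (cases x)
  case (Inf_path f)
  with assms show ?thesis
    by (auto simp: all_paths_def sink_paths_def infinite_paths_def split: nat.splits)
next
  case (Fin_path es v)
  have "is_edge_path G (e # es)"
    if "es \<noteq> []" "is_edge_path G es" "src G (hd es) \<in> rng G e"
    using that assms(1) unfolding is_edge_path_def
    by (auto simp: nth_Cons hd_conv_nth split: nat.splits)
  with assms Fin_path show ?thesis
    by (cases es) (auto simp: all_paths_def sink_paths_def infinite_paths_def is_edge_path_def)
qed

lemma path_cons_surj:
  assumes "x \<in> all_paths G" "first_edge x = Some e"
  obtains y where "y \<in> all_paths G" "path_src G y \<in> rng G e" "x = path_cons e y"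
proof (cases x)
  case (Inf_path f)
  have "path_cons e (Inf_path (\<lambda>n. f (Suc n))) = x"
    using assms Inf_path by (auto simp: fun_eq_iff split: nat.splits)
  moreover have "Inf_path (\<lambda>n. f (Suc n)) \<in> all_paths G" "src G (f (Suc 0)) \<in> rng G e"
    using assms Inf_path by (auto simp: all_paths_def sink_paths_def infinite_paths_def)
  ultimately show ?thesis using that[of "Inf_path (\<lambda>n. f (Suc n))"] by simp
next
  case (Fin_path es v)
  then obtain fs where fs: "es = e # fs" using assms by (cases es) auto
  have p: "is_edge_path G (e # fs)" "v \<in> rng G (last (e # fs))" "v \<in> sinks G"
    using assms Fin_path fs by (auto simp: all_paths_def sink_paths_def infinite_paths_def)
  have "is_edge_path G fs"
    unfolding is_edge_path_def
  proof (intro conjI allI impI)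
    show "set fs \<subseteq> edges G" using p(1) by (simp add: is_edge_path_def)
    show "src G (fs ! Suc i) \<in> rng G (fs ! i)" if "Suc i < length fs" for i
      using p(1) that unfolding is_edge_path_def by (auto dest: spec[of _ "Suc i"])
  qed
  moreover have "src G (hd fs) \<in> rng G e" if "fs \<noteq> []"
    using p(1) that unfolding is_edge_path_def by (auto simp: hd_conv_nth dest: spec[of _ 0])
  ultimately show ?thesis using that[of "Fin_path fs v"] p Fin_path fs
    by (cases fs) (auto simp: all_paths_def sink_paths_def)
qed

lemma path_branching_perfect:
  assumes G: "ultragraph G" and C: "C \<in> all_paths G // path_equiv G"
  shows "perfect_branching_system G (path_branching G C)"
proof -
  interpret ultragraph G by (rule G)
  let ?X = "path_branching G C"
  note eq = equiv_path_equiv[of G]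
  have sub: "C \<subseteq> all_paths G" by (rule in_quotient_imp_subset[OF eq C])
  have closed: "y \<in> C" if "x \<in> C" "y \<in> all_paths G" "tail_equivalent x y" for x y
    using in_quotient_imp_closed[OF eq C] that sub by (auto simp: path_equiv_def)
  have closed': "y \<in> C" if "x \<in> C" "y \<in> all_paths G" "tail_equivalent y x" for x y
    using closed[OF that(1,2)] that(3) by (blast intro: tail_equivalent_sym)
  have fe: "e \<in> edges G \<and> path_src G x = src G e" if "x \<in> all_paths G" "first_edge x = Some e" for x e
    using that by (cases "(G, x)" rule: path_src.cases)
      (auto simp: all_paths_def sink_paths_def infinite_paths_def is_edge_path_def)
  have src: "path_src G x \<in> verts G" if "x \<in> all_paths G" for x
    using that by (cases "(G, x)" rule: path_src.cases)
      (auto simp: all_paths_def sink_paths_def infinite_paths_def is_edge_path_def sinks_def src_in)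
  have nonsink: "\<exists>e. first_edge x = Some e" if "x \<in> all_paths G" "path_src G x \<notin> sinks G" for x
    using that by (cases "(G, x)" rule: path_src.cases)
      (auto simp: all_paths_def sink_paths_def infinite_paths_def)
  have emit: "D_set ?X {v} = (\<Union>e\<in>out_edges G v. R_set ?X e)" if "v \<notin> sinks G" for v
    using that fe nonsink by (fastforce simp: path_branching_def out_edges_def)
  have bij: "bij_betw (g_map ?X e) (D_set ?X (rng G e)) (R_set ?X e)" if e: "e \<in> edges G" for e
    unfolding bij_betw_def
  proof (intro conjI inj_onI equalityI subsetI)
    fix x y assume "g_map ?X e x = g_map ?X e y"
    then have "path_cons e x = path_cons e y" by (simp add: path_branching_def)
    then show "x = y" by (rule path_cons_inj)
  next
    fix y assume "y \<in> g_map ?X e ` D_set ?X (rng G e)"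
    then obtain x where x: "x \<in> C" "x \<in> all_paths G" "path_src G x \<in> rng G e" "y = path_cons e x"
      by (auto simp: path_branching_def)
    moreover have "first_edge (path_cons e x) = Some e" by (cases x) auto
    ultimately show "y \<in> R_set ?X e"
      using path_cons_mem[OF e, of x] closed[OF x(1) _ path_cons_tail[of x e]]
      by (simp add: path_branching_def)
  next
    fix y assume "y \<in> R_set ?X e"
    then have y: "y \<in> C" "y \<in> all_paths G" "first_edge y = Some e" by (auto simp: path_branching_def)
    then obtain x where x: "x \<in> all_paths G" "path_src G x \<in> rng G e" "y = path_cons e x"
      by (auto elim: path_cons_surj)
    then have "x \<in> C" using closed'[OF y(1) x(1)] path_cons_tail[of x e] by simp
    with x show "y \<in> g_map ?X e ` D_set ?X (rng G e)" by (auto simp: path_branching_def)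
  qed
  show ?thesis
  proof
    show "pts ?X = (\<Union>v\<in>verts G. D_set ?X {v})"
      using sub src by (auto simp: path_branching_def)
    show "R_set ?X e \<subseteq> D_set ?X {src G e}" if "e \<in> edges G" for e
      using fe by (auto simp: path_branching_def)
    show "D_set ?X {v} = (\<Union>e\<in>out_edges G v. R_set ?X e)"
      if "v \<in> verts G" "finite (out_edges G v)" "out_edges G v \<noteq> {}" for v
      using that by (intro emit) (auto simp: sinks_def)
    show "D_set ?X {v} = (\<Union>e\<in>out_edges G v. R_set ?X e)" if "v \<in> verts G - sinks G" for v
      using that by (intro emit) auto
    show "bij_betw (g_map ?X e) (D_set ?X (rng G e)) (R_set ?X e)" if "e \<in> edges G" for e
      using that by (rule bij)
  qed (auto simp: path_branching_def)
qed

end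

theory Submission
  imports Defs
begin

text \<open>In a perfect branching system every point \<open>x\<close> has an itinerary. It lies over exactly one
  vertex; if that vertex is not a sink, then \<open>x\<close> lies in exactly one \<open>R\<^sub>e\<close>, so \<open>x = g\<^sub>e y\<close> for a unique
  \<open>y\<close>, and the procedure goes on with \<open>y\<close>. The edges met form a path \<open>T x\<close>, finite when a sink is
  reached, and \<open>T (g\<^sub>e x) = e (T x)\<close>. The whole theorem is a statement about this labelling \<open>T\<close>: the
  representation is irreducible exactly when \<open>T\<close> is injective and its image is one equivalence class
  of paths (\<open>irreducible_iff_inj_class\<close>). Such a \<open>T\<close> is an isomorphism onto the class
  (\<open>isomorphic_path_branching\<close>), and every isomorphism onto a class is itself a labelling
  (\<open>isomorphism_path_labelling\<close>).

  Suppose that the representation is irreducible. Push-forward of finitely supported functions along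
  \<open>T\<close>, that is, summation over the fibres of \<open>T\<close>, commutes with the action, so its kernel is invariant.
  The kernel misses every point mass, and it contains the difference of two point masses whenever
  \<open>T\<close> identifies two points; hence \<open>T\<close> is injective (\<open>irreducible_imp_inj_on\<close>). The functions supported
  on a set of points closed under all \<open>g\<^sub>e\<close> and their inverses form an invariant submodule, so there is
  just one orbit (\<open>irreducible_imp_single_orbit\<close>), and its image is a class because tail equivalence is
  generated by identifying \<open>p\<close> with \<open>e p\<close> (\<open>cons_invariant_class\<close>).

  Conversely, take a nonzero element of an invariant submodule whose support is as small as possible.
  A projection \<open>p\<^sub>v\<close> or an operator \<open>s\<^sub>e\<^sup>*\<close> sends each point mass to a point mass or to zero, and distinct
  survivors stay distinct. If two points of the support had different itineraries, some product of
  these operators would kill one and not the other, and so make the support smaller (\<open>minimal_support_T_const\<close>). As \<open>T\<close> is injective, the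
  support is a single point. So the submodule contains a point mass, and the operators \<open>s\<^sub>e\<close> and
  \<open>s\<^sub>e\<^sup>*\<close> move it to every other point of the orbit.\<close>


section \<open>Paths and tail equivalence\<close>

definition cons_invariant :: "('v, 'e) ultragraph \<Rightarrow> ('v, 'e) path set \<Rightarrow> bool"
  where "cons_invariant G Q \<longleftrightarrow> (\<forall>e \<in> edges G. \<forall>p \<in> all_paths G.
    path_src G p \<in> rng G e \<longrightarrow> (p \<in> Q \<longleftrightarrow> path_cons e p \<in> Q))"

lemma first_edge_path_cons [simp]: "first_edge (path_cons e p) = Some e"
  by (cases p) auto

lemma path_src_path_cons [simp]: "path_src G (path_cons e p) = src G e"
  by (cases p) auto

lemma path_cons_eq_iff [simp]: "path_cons e p = path_cons f q \<longleftrightarrow> e = f \<and> p = q"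
proof
  assume eq: "path_cons e p = path_cons f q"
  then have "first_edge (path_cons e p) = first_edge (path_cons f q)" by simp
  then have "e = f" by simp
  with eq show "e = f \<and> p = q" using path_cons_inj by auto
qed simp

lemma first_edge_src:
  assumes "p \<in> all_paths G" "first_edge p = Some e"
  shows "e \<in> edges G" "path_src G p = src G e"
  using assms by (cases "(G, p)" rule: path_src.cases;
      auto simp: all_paths_def sink_paths_def infinite_paths_def is_edge_path_def)+

text \<open>A sink emits no edge and a path stops only at a sink, so the source decides whether a path is
  trivial.\<close>

lemma first_edge_None:
  assumes "p \<in> all_paths G"
  shows "first_edge p = None \<longleftrightarrow> path_src G p \<in> sinks G"
  using assms by (cases "(G, p)" rule: path_src.cases)
    (auto simp: all_paths_def sink_paths_def infinite_paths_def is_edge_path_def sinks_def out_edges_def)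

lemma first_edge_NoneD: "first_edge p = None \<Longrightarrow> p = Fin_path [] (path_src G p)"
  by (cases p rule: first_edge.cases) auto

text \<open>Tail equivalence is the equivalence relation generated by \<open>p \<sim> e p\<close>. A finite path is stripped of
  all its edges, down to its final sink; an infinite path is stripped of the initial segment before the
  common tail.\<close>

lemma cons_invariant_class:
  assumes Q: "cons_invariant G Q" and p: "p \<in> all_paths G" and q: "q \<in> all_paths G"
    and pq: "tail_equivalent p q" and pQ: "p \<in> Q"
  shows "q \<in> Q"
proof -
  have step: "r \<in> all_paths G \<and> (r \<in> Q \<longleftrightarrow> path_cons e r \<in> Q)"
    if er: "path_cons e r \<in> all_paths G" for e r
  proof -
    obtain r' where "r' \<in> all_paths G" "path_src G r' \<in> rng G e" "path_cons e r = path_cons e r'"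
      by (rule path_cons_surj[OF er first_edge_path_cons])
    moreover have "e \<in> edges G" using first_edge_src(1)[OF er first_edge_path_cons] .
    ultimately show ?thesis using Q by (simp add: cons_invariant_def)
  qed
  have fin: "Fin_path [] v \<in> all_paths G \<and> (Fin_path es v \<in> Q \<longleftrightarrow> Fin_path [] v \<in> Q)"
    if "Fin_path es v \<in> all_paths G" for es v
    using that
  proof (induction es)
    case (Cons e es)
    then have "path_cons e (Fin_path es v) \<in> all_paths G" by simp
    from step[OF this] Cons.IH show ?case by simp
  qed simp
  have inf: "Inf_path (\<lambda>k. f (n + k)) \<in> all_paths G \<and> (Inf_path f \<in> Q \<longleftrightarrow> Inf_path (\<lambda>k. f (n + k)) \<in> Q)"
    if "Inf_path f \<in> all_paths G" for f n
  proof (induction n)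
    case (Suc n)
    have "path_cons (f n) (Inf_path (\<lambda>k. f (Suc n + k))) = Inf_path (\<lambda>k. f (n + k))"
      by (auto simp: fun_eq_iff split: nat.splits)
    with Suc.IH step[of "f n" "Inf_path (\<lambda>k. f (Suc n + k))"] show ?case by simp
  qed (use that in simp)
  from pq show ?thesis
  proof (cases rule: tail_equivalent.cases[of "(p, q)"])
    case (1 a v b w)
    then have "v = w" using pq by simp
    with 1 show ?thesis using fin[of a v] fin[of b v] p q pQ by blast
  next
    case (2 f g)
    then obtain i j where "\<And>k. f (i + k) = g (j + k)" using pq by auto
    then show ?thesis using 2 inf[of f i] inf[of g j] p q pQ by simp
  qed (use pq in auto)
qed

text \<open>A path is determined by its sequence of observations "which edge comes next, or which sink is
  this", so related paths agree if a relation can be followed step by step. The hypotheses are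
  one-sided: they speak of the left path only. This is enough, since a finite path on the right is
  exhausted after finitely many steps.\<close>

lemma path_bisimulation:
  assumes sink: "\<And>v q. (Fin_path [] v, q) \<in> B \<Longrightarrow> q = Fin_path [] v"
    and cons: "\<And>e p q. (path_cons e p, q) \<in> B \<Longrightarrow> \<exists>q'. q = path_cons e q' \<and> (p, q') \<in> B"
    and pq: "(p, q) \<in> B"
  shows "p = q"
proof (cases p)
  case (Fin_path es v)
  have "q = Fin_path es v" if "(Fin_path es v, q) \<in> B" for q
    using that
  proof (induction es arbitrary: q)
    case (Cons e es)
    have "(path_cons e (Fin_path es v), q) \<in> B" using Cons.prems by simp
    from cons[OF this] obtain q' where "q = path_cons e q'" "(Fin_path es v, q') \<in> B" by blast
    with Cons.IH[of q'] show ?case by simp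
  qed (rule sink)
  with Fin_path pq show ?thesis by metis
next
  case (Inf_path f)
  have inf: "\<exists>q'. q = path_cons (f 0) q' \<and> (Inf_path (\<lambda>k. f (Suc k)), q') \<in> B"
    if "(Inf_path f, q) \<in> B" for f q
  proof (rule cons)
    have "path_cons (f 0) (Inf_path (\<lambda>k. f (Suc k))) = Inf_path f"
      by (auto simp: fun_eq_iff split: nat.splits)
    with that show "(path_cons (f 0) (Inf_path (\<lambda>k. f (Suc k))), q) \<in> B" by simp
  qed
  have nofin: "(Inf_path f, Fin_path es v) \<notin> B" for f es v
  proof (induction es arbitrary: f)
    case Nil
    show ?case using inf[of f "Fin_path [] v"] by (metis first_edge.simps(1) first_edge_path_cons option.distinct(1))
  next
    case (Cons e es)
    show ?case
    proof
      assume "(Inf_path f, Fin_path (e # es) v) \<in> B"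
      then obtain q' where "Fin_path (e # es) v = path_cons (f 0) q'" "(Inf_path (\<lambda>k. f (Suc k)), q') \<in> B"
        using inf by blast
      with Cons show False by (cases q') auto
    qed
  qed
  have eq: "f n = g n" if "(Inf_path f, Inf_path g) \<in> B" for f g n
    using that
  proof (induction n arbitrary: f g)
    case 0
    from inf[OF 0] obtain q' where "Inf_path g = path_cons (f 0) q'" "(Inf_path (\<lambda>k. f (Suc k)), q') \<in> B"
      by (elim exE conjE)
    then show ?case by (cases q') auto
  next
    case (Suc n)
    from inf[OF Suc.prems] obtain q' where q': "Inf_path g = path_cons (f 0) q'"
      "(Inf_path (\<lambda>k. f (Suc k)), q') \<in> B" by (elim exE conjE)
    then obtain g' where "q' = Inf_path g'" by (cases q') auto
    with q' Suc.IH[of "\<lambda>k. f (Suc k)" g'] show ?case by simp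
  qed
  show ?thesis using Inf_path pq nofin eq by (cases q) auto
qed


section \<open>Labelling the points of a branching system by paths\<close>

text \<open>The conditions on \<open>D\<close> and \<open>R\<close> are equivalences, not just the inclusions required of a morphism.
  Thus the label of a point decides which \<open>D\<^sub>A\<close> and \<open>R\<^sub>e\<close> contain it, so that the fibres of \<open>T\<close> are
  respected by all the operators, and a bijective labelling has a morphism as its inverse.\<close>

locale path_labelling = branching_system G X
  for G :: "('v, 'e) ultragraph" and X :: "('v, 'e, 'x) branching" +
  fixes T :: "'x \<Rightarrow> ('v, 'e) path"
  assumes T_path: "x \<in> pts X \<Longrightarrow> T x \<in> all_paths G"
    and T_D: "\<lbrakk>A \<in> vertex_sets G; x \<in> pts X\<rbrakk> \<Longrightarrow> x \<in> D_set X A \<longleftrightarrow> path_src G (T x) \<in> A"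
    and T_R: "\<lbrakk>e \<in> edges G; x \<in> pts X\<rbrakk> \<Longrightarrow> x \<in> R_set X e \<longleftrightarrow> first_edge (T x) = Some e"
    and T_g: "\<lbrakk>e \<in> edges G; x \<in> D_set X (rng G e)\<rbrakk> \<Longrightarrow> T (g_map X e x) = path_cons e (T x)"
begin

lemma g_props:
  assumes "e \<in> edges G" "x \<in> D_set X (rng G e)"
  shows "x \<in> pts X" "g_map X e x \<in> R_set X e" "g_map X e x \<in> pts X"
    "inv_into (D_set X (rng G e)) (g_map X e) (g_map X e x) = x"
proof -
  note b = g_bij[OF assms(1)]
  show "x \<in> pts X" using D_sub[OF vertex_sets.range[OF assms(1)]] assms(2) by blast
  show R: "g_map X e x \<in> R_set X e" using b assms(2) by (auto dest: bij_betwE)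
  show "g_map X e x \<in> pts X" using R R_sub[OF assms(1)] by blast
  show "inv_into (D_set X (rng G e)) (g_map X e) (g_map X e x) = x"
    by (rule bij_betw_inv_into_left[OF b assms(2)])
qed

lemma T_cons:
  assumes e: "e \<in> edges G" and x: "x \<in> pts X" and Tx: "T x = path_cons e p"
  obtains y where "y \<in> D_set X (rng G e)" "x = g_map X e y" "T y = p"
proof -
  have "x \<in> R_set X e" using T_R[OF e x] Tx by simp
  then obtain y where y: "y \<in> D_set X (rng G e)" "x = g_map X e y"
    using g_bij[OF e] by (auto simp: bij_betw_def)
  with T_g[OF e y(1)] Tx that show ?thesis by simp
qed

definition orbit_closed :: "'x set \<Rightarrow> bool"
  where "orbit_closed S \<longleftrightarrow> S \<subseteq> pts X \<and>
    (\<forall>e \<in> edges G. \<forall>x \<in> D_set X (rng G e). x \<in> S \<longleftrightarrow> g_map X e x \<in> S)"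

lemma cons_invariant_image:
  assumes S: "orbit_closed S"
  shows "cons_invariant G (T ` S)"
  unfolding cons_invariant_def
proof (intro ballI impI iffI)
  fix e p assume e: "e \<in> edges G" and p: "path_src G p \<in> rng G e"
  note closed = S[unfolded orbit_closed_def, THEN conjunct2, rule_format, OF e]
  have sub: "x \<in> pts X" if "x \<in> S" for x using S that by (auto simp: orbit_closed_def)
  {
    assume "p \<in> T ` S"
    then obtain x where x: "x \<in> S" "p = T x" by blast
    then have D: "x \<in> D_set X (rng G e)" using T_D[OF vertex_sets.range[OF e] sub] p by simp
    then show "path_cons e p \<in> T ` S"
      using T_g[OF e D] closed[OF D] x by (intro image_eqI[of _ _ "g_map X e x"]) simp_all
  next
    assume "path_cons e p \<in> T ` S"
    then obtain y where y: "y \<in> S" "path_cons e p = T y" by blast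
    obtain x where x: "x \<in> D_set X (rng G e)" "y = g_map X e x" "T x = p"
      using T_cons[OF e sub[OF y(1)] y(2)[symmetric]] by blast
    then show "p \<in> T ` S" using closed[OF x(1)] y(1) by blast
  }
qed

lemma isomorphic_path_branching:
  assumes bij: "bij_betw T (pts X) C" and C: "C \<subseteq> all_paths G"
  shows "branching_isomorphic G X (path_branching G C)"
proof -
  let ?U = "inv_into (pts X) T"
  have U: "?U p \<in> pts X" "T (?U p) = p" if "p \<in> C" for p
    using bij that by (metis bij_betw_imp_surj_on inv_into_into, metis bij_betw_inv_into_right)
  have UT: "?U (T x) = x" "T x \<in> C" if "x \<in> pts X" for x
    using bij that by (metis bij_betw_inv_into_left, metis bij_betwE)
  have "branching_morphism G X (path_branching G C) T"
    unfolding branching_morphism_def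
  proof (intro conjI ballI subsetI; (elim imageE)?)
    show "T \<in> pts X \<rightarrow> pts (path_branching G C)" using UT by (simp add: path_branching_def)
    show "p \<in> R_set (path_branching G C) e" if "e \<in> edges G" "p = T x" "x \<in> R_set X e" for e p x
    proof -
      have "x \<in> pts X" using R_sub that by blast
      with that UT T_path T_R[of e x] show ?thesis by (simp add: path_branching_def)
    qed
    show "p \<in> D_set (path_branching G C) A" if "A \<in> vertex_sets G" "p = T x" "x \<in> D_set X A" for A p x
    proof -
      have "x \<in> pts X" using D_sub that by blast
      with that UT T_path T_D[of A x] show ?thesis by (simp add: path_branching_def)
    qed
  qed (simp add: path_branching_def T_g)
  moreover have "branching_morphism G (path_branching G C) X ?U"
    unfolding branching_morphism_def path_branching_def
  proof (simp, intro conjI ballI subsetI; (elim imageE)?)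
    show "?U \<in> C \<rightarrow> pts X" using U by simp
    show "x \<in> R_set X e" if "e \<in> edges G" "x = ?U p" "p \<in> {x \<in> all_paths G. first_edge x = Some e} \<inter> C" for e x p
      using that U[of p] T_R[of e x] by auto
    show "x \<in> D_set X A" if "A \<in> vertex_sets G" "x = ?U p" "p \<in> {x \<in> all_paths G. path_src G x \<in> A} \<inter> C" for A x p
      using that U[of p] T_D[of A x] by auto
    show "?U (path_cons e p) = g_map X e (?U p)"
      if e: "e \<in> edges G" and p: "p \<in> {x \<in> all_paths G. path_src G x \<in> rng G e} \<inter> C" for e p
    proof -
      have "?U p \<in> D_set X (rng G e)"
        using p U[of p] T_D[OF vertex_sets.range[OF e], of "?U p"] by auto
      with T_g[OF e this] g_props[OF e this] UT(1)[of "g_map X e (?U p)"] p U(2)[of p]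
      show ?thesis by simp
    qed
  qed
  ultimately show ?thesis
    unfolding branching_isomorphic_def using U UT
    by (intro exI[of _ T] exI[of _ ?U]) (auto simp: path_branching_def)
qed

end

text \<open>The inverse morphism supplies the converse implications: it carries \<open>T x \<in> B\<^sub>A\<close> back to
  \<open>x \<in> D\<^sub>A\<close>.\<close>

lemma (in branching_system) isomorphism_path_labelling:
  assumes iso: "branching_isomorphic G X (path_branching G C)" and C: "C \<subseteq> all_paths G"
  obtains T where "path_labelling G X T" "bij_betw T (pts X) C"
proof -
  obtain T U where T: "branching_morphism G X (path_branching G C) T"
    and U: "branching_morphism G (path_branching G C) X U"
    and inv: "\<And>x. x \<in> pts X \<Longrightarrow> U (T x) = x" "\<And>p. p \<in> C \<Longrightarrow> T (U p) = p"
    using iso by (auto simp: branching_isomorphic_def path_branching_def)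
  have TC: "T x \<in> C" if "x \<in> pts X" for x
    using T that by (auto simp: branching_morphism_def path_branching_def)
  have UX: "U p \<in> pts X" if "p \<in> C" for p
    using U that by (auto simp: branching_morphism_def path_branching_def)
  have "bij_betw T (pts X) C"
    by (rule bij_betw_byWitness[of _ U]) (use inv TC UX in auto)
  moreover have "path_labelling G X T"
  proof
    fix x assume x: "x \<in> pts X"
    then show "T x \<in> all_paths G" using TC C by blast
    show "x \<in> D_set X A \<longleftrightarrow> path_src G (T x) \<in> A" if A: "A \<in> vertex_sets G" for A
    proof
      assume "x \<in> D_set X A"
      with T A have "T x \<in> D_set (path_branching G C) A" unfolding branching_morphism_def by blast
      then show "path_src G (T x) \<in> A" by (simp add: path_branching_def)
    next
      assume "path_src G (T x) \<in> A"
      then have "T x \<in> D_set (path_branching G C) A" using TC[OF x] C by (auto simp: path_branching_def)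
      with U A have "U (T x) \<in> D_set X A" unfolding branching_morphism_def by blast
      with inv(1)[OF x] show "x \<in> D_set X A" by simp
    qed
    show "x \<in> R_set X e \<longleftrightarrow> first_edge (T x) = Some e" if e: "e \<in> edges G" for e
    proof
      assume "x \<in> R_set X e"
      with T e have "T x \<in> R_set (path_branching G C) e" unfolding branching_morphism_def by blast
      then show "first_edge (T x) = Some e" by (simp add: path_branching_def)
    next
      assume "first_edge (T x) = Some e"
      then have "T x \<in> R_set (path_branching G C) e" using TC[OF x] C by (auto simp: path_branching_def)
      with U e have "U (T x) \<in> R_set X e" unfolding branching_morphism_def by blast
      with inv(1)[OF x] show "x \<in> R_set X e" by simp
    qed
  next
    show "T (g_map X e x) = path_cons e (T x)" if "e \<in> edges G" "x \<in> D_set X (rng G e)" for e x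
      using T that by (auto simp: branching_morphism_def path_branching_def)
  qed
  ultimately show ?thesis using that by blast
qed


section \<open>Invariant submodules of the induced representation\<close>

text \<open>The elements of the algebra are classes of terms in the generators, and a submodule is closed
  under the operations that build the terms.\<close>

lemma branching_rep_invariantI:
  assumes X: "branching_system G X" and R: "cring R"
    and N: "submodule N R (finsupp_maps R (pts X))"
    and gens: "\<And>g \<phi>. \<lbrakk>g \<in> leavitt_gens G; \<phi> \<in> N\<rbrakk> \<Longrightarrow> gen_action R G X g \<phi> \<in> N"
    and a: "a \<in> carrier (leavitt_path_algebra R G)" and \<phi>: "\<phi> \<in> N"
  shows "branching_rep R G X a \<phi> \<in> N"
proof -
  let ?M = "finsupp_maps R (pts X)"
  let ?E = "End_algebra R ?M"
  define h where "h = (\<lambda>g. restrict (gen_action R G X g) (carrier ?M))"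
  interpret M: module R ?M by (rule finsupp_module[OF R])
  interpret E: nu_algebra R ?E by (rule End_nu_algebra[OF M.module_axioms])
  note sub = M.submoduleE[OF N]
  have c: "\<phi> \<in> carrier ?M" if "\<phi> \<in> N" for \<phi> using sub(1) that by blast
  have zero: "\<zero>\<^bsub>?M\<^esub> \<in> N"
    using subgroup.one_closed[OF submodule.axioms(1)[OF N]] by simp
  have h: "h \<in> leavitt_gens G \<rightarrow> carrier ?E" unfolding h_def using gen_action_End[OF X R] by blast
  from a obtain t where t: "t \<in> alg_terms R (leavitt_gens G)"
    and at: "a = alg_cong R (leavitt_gens G) (leavitt_rels G) `` {t}"
    unfolding leavitt_path_algebra_def by (rule presented_carrierE)
  have "branching_rep R G X a = alg_eval ?E h t"
    unfolding at branching_rep_def h_def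
    by (rule presented_lift_class[OF E.nu_algebra_axioms h[unfolded h_def] gen_action_relations[OF X R] t])
  moreover have "alg_eval ?E h t \<phi> \<in> N" if "\<phi> \<in> N" for \<phi>
    using t that
  proof (induction arbitrary: \<phi>)
    case (1 g)
    with gens[OF 1] c show ?case by (simp add: h_def)
  next
    case 2
    with c show ?case by (simp add: End_algebra_def zero)
  next
    case (3 t)
    have "alg_eval ?E h t \<in> carrier ?E" by (rule alg_eval_closed[OF E.nu_algebra_axioms h 3(1)])
    then have "alg_eval ?E h (TNeg t) = (\<ominus>\<^bsub>R\<^esub> \<one>\<^bsub>R\<^esub>) \<odot>\<^bsub>?E\<^esub> alg_eval ?E h t"
      by (simp add: E.smult_l_minus)
    moreover have "((\<ominus>\<^bsub>R\<^esub> \<one>\<^bsub>R\<^esub>) \<odot>\<^bsub>?E\<^esub> f) \<phi> = (\<ominus>\<^bsub>R\<^esub> \<one>\<^bsub>R\<^esub>) \<odot>\<^bsub>?M\<^esub> f \<phi>" for f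
      using c[OF 3(3)] by (simp add: End_algebra_def)
    ultimately show ?case using sub(4)[OF _ 3(2)[OF 3(3)], of "\<ominus>\<^bsub>R\<^esub> \<one>\<^bsub>R\<^esub>"] by simp
  next
    case (4 t u)
    have "(f \<oplus>\<^bsub>?E\<^esub> f') \<phi> = f \<phi> \<oplus>\<^bsub>?M\<^esub> f' \<phi>" for f f'
      using c[OF 4(5)] by (simp add: End_algebra_def)
    then show ?case using sub(5)[OF 4(3)[OF 4(5)] 4(4)[OF 4(5)]] by simp
  next
    case (5 t u)
    have "(f \<otimes>\<^bsub>?E\<^esub> f') \<phi> = f (f' \<phi>)" for f f'
      using c[OF 5(5)] by (simp add: End_algebra_def compose_def)
    then show ?case using 5(3)[OF 5(4)[OF 5(5)]] by simp
  next
    case (6 k t)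
    have "(k \<odot>\<^bsub>?E\<^esub> f) \<phi> = k \<odot>\<^bsub>?M\<^esub> f \<phi>" for f
      using c[OF 6(4)] by (simp add: End_algebra_def)
    then show ?case using sub(4)[OF 6(1) 6(3)[OF 6(4)]] by simp
  qed
  ultimately show ?thesis using \<phi> by simp
qed

lemma branching_rep_irreducible_iff:
  assumes X: "branching_system G X" and R: "cring R"
  defines "M \<equiv> finsupp_maps R (pts X)"
  shows "irreducible_representation R (leavitt_path_algebra R G) M (branching_rep R G X) \<longleftrightarrow>
    carrier M \<noteq> {\<zero>\<^bsub>M\<^esub>} \<and>
    (\<forall>N. submodule N R M \<and> (\<forall>g \<in> leavitt_gens G. \<forall>\<phi> \<in> N. gen_action R G X g \<phi> \<in> N) \<longrightarrow>
      N = {\<zero>\<^bsub>M\<^esub>} \<or> N = carrier M)"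
proof -
  interpret M: module R M unfolding M_def by (rule finsupp_module[OF R])
  let ?inv = "\<lambda>N. \<forall>a \<in> carrier (leavitt_path_algebra R G). \<forall>\<phi> \<in> N. branching_rep R G X a \<phi> \<in> N"
  let ?ginv = "\<lambda>N. \<forall>g \<in> leavitt_gens G. \<forall>\<phi> \<in> N. gen_action R G X g \<phi> \<in> N"
  have "?inv N \<longleftrightarrow> ?ginv N"
    if N: "submodule N R M" for N
  proof
    assume a: "?inv N"
    show "?ginv N"
    proof (intro ballI)
      fix g \<phi> assume g: "g \<in> leavitt_gens G" and \<phi>: "\<phi> \<in> N"
      have "leavitt_class R G g \<in> carrier (leavitt_path_algebra R G)"
        unfolding leavitt_class_def leavitt_path_algebra_def
        by (intro presented_carrierI alg_terms.intros g)
      moreover have "\<phi> \<in> carrier (finsupp_maps R (pts X))" using M.submoduleE(1)[OF N] \<phi> M_def by auto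
      ultimately show "gen_action R G X g \<phi> \<in> N" using a \<phi> branching_rep_gen[OF X R g, of \<phi>] by metis
    qed
  next
    assume "?ginv N"
    then show "?inv N" using branching_rep_invariantI[OF X R N[unfolded M_def]] by blast
  qed
  then have "submodule N R M \<and> ?inv N \<longleftrightarrow> submodule N R M \<and> ?ginv N" for N by blast
  moreover have "representation R (leavitt_path_algebra R G) M (branching_rep R G X)"
    unfolding M_def by (rule branching_rep_representation[OF X R])
  ultimately show ?thesis unfolding irreducible_representation_def by (simp only:) simp
qed

text \<open>Negatives are scalar multiples.\<close>

lemma (in module) submoduleI_smult:
  assumes "H \<subseteq> carrier M" and "\<zero>\<^bsub>M\<^esub> \<in> H"
    and "\<And>x y. \<lbrakk>x \<in> H; y \<in> H\<rbrakk> \<Longrightarrow> x \<oplus>\<^bsub>M\<^esub> y \<in> H"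
    and smult: "\<And>c x. \<lbrakk>c \<in> carrier R; x \<in> H\<rbrakk> \<Longrightarrow> c \<odot>\<^bsub>M\<^esub> x \<in> H"
  shows "submodule H R M"
proof (rule submoduleI)
  show "\<ominus>\<^bsub>M\<^esub> x \<in> H" if "x \<in> H" for x
    using smult[of "\<ominus>\<^bsub>R\<^esub> \<one>\<^bsub>R\<^esub>" x] that assms(1) by (auto simp: smult_l_minus)
qed (use assms in auto)

locale labelled_representation = path_labelling G X T + R: field R
  for G :: "('v, 'e) ultragraph" and X :: "('v, 'e, 'x) branching" and T
    and R :: "('k, 'm) ring_scheme" (structure)
begin

abbreviation M :: "('k, 'x \<Rightarrow> 'k) module" where "M \<equiv> finsupp_maps R (pts X)"

sublocale M: module R M by (rule finsupp_module[OF R.is_cring])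

definition invariant :: "('x \<Rightarrow> 'k) set \<Rightarrow> bool"
  where "invariant N \<longleftrightarrow> submodule N R M \<and>
    (\<forall>g \<in> leavitt_gens G. \<forall>\<phi> \<in> N. gen_action R G X g \<phi> \<in> N)"

abbreviation irreducible_rep :: bool
  where "irreducible_rep \<equiv>
    irreducible_representation R (leavitt_path_algebra R G) M (branching_rep R G X)"

lemma irreducible_rep_iff:
  "irreducible_rep \<longleftrightarrow> carrier M \<noteq> {\<zero>\<^bsub>M\<^esub>} \<and> (\<forall>N. invariant N \<longrightarrow> N = {\<zero>\<^bsub>M\<^esub>} \<or> N = carrier M)"
  unfolding invariant_def
  by (rule branching_rep_irreducible_iff[OF branching_system_axioms R.is_cring])

lemma M_carrier: "\<phi> \<in> carrier M \<longleftrightarrow>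
    (\<forall>x. \<phi> x \<in> carrier R) \<and> (\<forall>x. x \<notin> pts X \<longrightarrow> \<phi> x = \<zero>) \<and> finite {x. \<phi> x \<noteq> \<zero>}"
  and M_ops: "\<zero>\<^bsub>M\<^esub> = (\<lambda>x. \<zero>)" "\<phi> \<oplus>\<^bsub>M\<^esub> \<chi> = (\<lambda>x. \<phi> x \<oplus> \<chi> x)" "c \<odot>\<^bsub>M\<^esub> \<phi> = (\<lambda>x. c \<otimes> \<phi> x)"
  by (simp_all add: finsupp_maps_def)

lemma M_D:
  assumes "\<phi> \<in> carrier M"
  shows "\<phi> x \<in> carrier R" "\<phi> x \<noteq> \<zero> \<Longrightarrow> x \<in> pts X" "finite {x. \<phi> x \<noteq> \<zero>}"
  using assms by (auto simp: M_carrier)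

lemma gen_action_closed:
  assumes "g \<in> leavitt_gens G" "\<phi> \<in> carrier M"
  shows "gen_action R G X g \<phi> \<in> carrier M"
  using gen_action_End[OF branching_system_axioms R.is_cring assms(1)] assms(2)
  by (auto simp: End_algebra_def linear_endos_def)

lemma invariantI:
  assumes "N \<subseteq> carrier M" "\<zero>\<^bsub>M\<^esub> \<in> N"
    and "\<And>\<phi> \<chi>. \<lbrakk>\<phi> \<in> N; \<chi> \<in> N\<rbrakk> \<Longrightarrow> \<phi> \<oplus>\<^bsub>M\<^esub> \<chi> \<in> N"
    and "\<And>c \<phi>. \<lbrakk>c \<in> carrier R; \<phi> \<in> N\<rbrakk> \<Longrightarrow> c \<odot>\<^bsub>M\<^esub> \<phi> \<in> N"
    and "\<And>g \<phi>. \<lbrakk>g \<in> leavitt_gens G; \<phi> \<in> N\<rbrakk> \<Longrightarrow> gen_action R G X g \<phi> \<in> N"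
  shows "invariant N"
  unfolding invariant_def using assms by (blast intro: M.submoduleI_smult)

lemma invariantD:
  assumes N: "invariant N"
  shows "\<phi> \<in> N \<Longrightarrow> \<phi> \<in> carrier M" "\<zero>\<^bsub>M\<^esub> \<in> N"
    "\<lbrakk>\<phi> \<in> N; \<chi> \<in> N\<rbrakk> \<Longrightarrow> \<phi> \<oplus>\<^bsub>M\<^esub> \<chi> \<in> N"
    "\<lbrakk>c \<in> carrier R; \<phi> \<in> N\<rbrakk> \<Longrightarrow> c \<odot>\<^bsub>M\<^esub> \<phi> \<in> N"
    "\<lbrakk>g \<in> leavitt_gens G; \<phi> \<in> N\<rbrakk> \<Longrightarrow> gen_action R G X g \<phi> \<in> N"
proof -
  have sub: "submodule N R M" using N by (simp add: invariant_def)
  show "\<phi> \<in> N \<Longrightarrow> \<phi> \<in> carrier M" using M.submoduleE(1)[OF sub] by blast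
  show "\<zero>\<^bsub>M\<^esub> \<in> N" using subgroup.one_closed[OF submodule.axioms(1)[OF sub]] by simp
  show "\<lbrakk>\<phi> \<in> N; \<chi> \<in> N\<rbrakk> \<Longrightarrow> \<phi> \<oplus>\<^bsub>M\<^esub> \<chi> \<in> N" by (rule M.submoduleE(5)[OF sub])
  show "\<lbrakk>c \<in> carrier R; \<phi> \<in> N\<rbrakk> \<Longrightarrow> c \<odot>\<^bsub>M\<^esub> \<phi> \<in> N" by (rule M.submoduleE(4)[OF sub])
  show "\<lbrakk>g \<in> leavitt_gens G; \<phi> \<in> N\<rbrakk> \<Longrightarrow> gen_action R G X g \<phi> \<in> N"
    using N by (simp add: invariant_def)
qed

lemma leavitt_gens_cases:
  assumes "g \<in> leavitt_gens G"
  obtains (Proj) A where "A \<in> vertex_sets G" "g = Proj A"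
  | (Edge) e where "e \<in> edges G" "g = Edge e" | (Ghost) e where "e \<in> edges G" "g = Ghost e"
  using assms by (auto simp: leavitt_gens_def)

lemma Edge_action_g [simp]:
  assumes "e \<in> edges G" "x \<in> D_set X (rng G e)"
  shows "gen_action R G X (Edge e) \<phi> (g_map X e x) = \<phi> x"
  using g_props[OF assms] by simp

definition point_mass :: "'x \<Rightarrow> 'x \<Rightarrow> 'k" where "point_mass x = (\<lambda>y. if y = x then \<one> else \<zero>)"

lemma point_mass_carrier: "x \<in> pts X \<Longrightarrow> point_mass x \<in> carrier M"
  by (auto simp: M_carrier point_mass_def)

lemma point_mass_nonzero: "point_mass x \<noteq> \<zero>\<^bsub>M\<^esub>"
proof
  assume "point_mass x = \<zero>\<^bsub>M\<^esub>"
  then have "point_mass x x = \<zero>" by (simp add: M_ops)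
  then show False by (simp add: point_mass_def)
qed

lemma Edge_point_mass:
  assumes e: "e \<in> edges G" and x: "x \<in> D_set X (rng G e)"
  shows "gen_action R G X (Edge e) (point_mass x) = point_mass (g_map X e x)"
proof
  fix y
  show "gen_action R G X (Edge e) (point_mass x) y = point_mass (g_map X e x) y"
  proof (cases "y \<in> R_set X e")
    case True
    then obtain z where z: "z \<in> D_set X (rng G e)" "y = g_map X e z"
      using g_bij[OF e] by (auto simp: bij_betw_def)
    have "g_map X e z = g_map X e x \<longleftrightarrow> z = x" using g_props(4)[OF e] z(1) x by metis
    with Edge_action_g[OF e z(1)] z(2) show ?thesis by (simp add: point_mass_def del: gen_action.simps)
  next
    case False
    with g_props(2)[OF e x] show ?thesis by (auto simp: point_mass_def)
  qed
qed

lemma Ghost_point_mass: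
  assumes e: "e \<in> edges G" and x: "x \<in> D_set X (rng G e)"
  shows "gen_action R G X (Ghost e) (point_mass (g_map X e x)) = point_mass x"
proof
  fix y
  have "g_map X e y = g_map X e x \<longleftrightarrow> y = x" if "y \<in> D_set X (rng G e)"
    using g_props(4)[OF e] that x by metis
  with x show "gen_action R G X (Ghost e) (point_mass (g_map X e x)) y = point_mass x y"
    by (auto simp: point_mass_def)
qed

lemma in_invariantI_point_masses:
  assumes N: "invariant N" and pm: "\<And>x. x \<in> pts X \<Longrightarrow> point_mass x \<in> N" and \<phi>: "\<phi> \<in> carrier M"
  shows "\<phi> \<in> N"
  using \<phi>
proof (induction "card {x. \<phi> x \<noteq> \<zero>}" arbitrary: \<phi>)
  case 0
  then have "\<phi> = \<zero>\<^bsub>M\<^esub>" by (auto simp: M_ops M_carrier)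
  then show ?case using invariantD(2)[OF N] by simp
next
  case (Suc n)
  from Suc.hyps(2) obtain x where x: "\<phi> x \<noteq> \<zero>" by fastforce
  note \<phi> = M_D[OF Suc.prems]
  let ?\<phi> = "\<phi>(x := \<zero>)"
  have "{y. ?\<phi> y \<noteq> \<zero>} = {y. \<phi> y \<noteq> \<zero>} - {x}" by auto
  then have "card {y. ?\<phi> y \<noteq> \<zero>} = n" "finite {y. ?\<phi> y \<noteq> \<zero>}"
    using Suc.hyps(2) x \<phi>(3) by simp_all
  moreover from this have "?\<phi> \<in> carrier M" using Suc.prems by (auto simp: M_carrier)
  ultimately have "?\<phi> \<in> N" using Suc.hyps(1) by blast
  moreover have "\<phi> x \<odot>\<^bsub>M\<^esub> point_mass x \<in> N"
    by (intro invariantD(4)[OF N] pm \<phi>(1,2) x)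
  moreover have "\<phi> = ?\<phi> \<oplus>\<^bsub>M\<^esub> \<phi> x \<odot>\<^bsub>M\<^esub> point_mass x"
    using \<phi>(1) by (auto simp: M_ops point_mass_def)
  ultimately show ?case using invariantD(3)[OF N] by metis
qed


section \<open>Irreducibility forces injectivity and a single class\<close>

definition fibre_sum :: "('x \<Rightarrow> 'k) \<Rightarrow> ('v, 'e) path \<Rightarrow> 'k"
  where "fibre_sum \<phi> q = (\<Oplus>x\<in>{x. \<phi> x \<noteq> \<zero> \<and> T x = q}. \<phi> x)"

text \<open>Replacing the support by a larger finite part of the fibre lets functions with different
  supports be summed over a common set.\<close>

lemma fibre_sum_eq:
  assumes "finite A" "\<And>x. \<phi> x \<in> carrier R"
    and "\<And>x. \<lbrakk>\<phi> x \<noteq> \<zero>; T x = q\<rbrakk> \<Longrightarrow> x \<in> A" "\<And>x. x \<in> A \<Longrightarrow> T x = q"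
  shows "(\<Oplus>x\<in>A. \<phi> x) = fibre_sum \<phi> q"
  unfolding fibre_sum_def
  by (rule R.add.finprod_mono_neutral_cong_right) (use assms in auto)

lemma fibre_sum_add:
  assumes "\<phi> \<in> carrier M" "\<chi> \<in> carrier M"
  shows "fibre_sum (\<phi> \<oplus>\<^bsub>M\<^esub> \<chi>) q = fibre_sum \<phi> q \<oplus> fibre_sum \<chi> q"
proof -
  note \<phi> = M_D[OF assms(1)] and \<chi> = M_D[OF assms(2)]
  let ?A = "{x. (\<phi> x \<noteq> \<zero> \<or> \<chi> x \<noteq> \<zero>) \<and> T x = q}"
  have fin: "finite ?A" by (rule finite_subset[OF _ finite_UnI[OF \<phi>(3) \<chi>(3)]]) auto
  have eqs: "(\<Oplus>x\<in>?A. \<psi> x) = fibre_sum \<psi> q"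
    if "\<And>x. \<psi> x \<in> carrier R" "\<And>x. \<psi> x \<noteq> \<zero> \<Longrightarrow> \<phi> x \<noteq> \<zero> \<or> \<chi> x \<noteq> \<zero>" for \<psi>
    by (rule fibre_sum_eq[OF fin]) (use that in auto)
  have "fibre_sum (\<phi> \<oplus>\<^bsub>M\<^esub> \<chi>) q = (\<Oplus>x\<in>?A. \<phi> x \<oplus> \<chi> x)"
    unfolding M_ops by (rule eqs[symmetric]) (use \<phi>(1) \<chi>(1) in auto)
  also have "\<dots> = (\<Oplus>x\<in>?A. \<phi> x) \<oplus> (\<Oplus>x\<in>?A. \<chi> x)"
    by (rule R.finsum_addf) (use \<phi>(1) \<chi>(1) in auto)
  finally show ?thesis using eqs \<phi>(1) \<chi>(1) by simp
qed

lemma fibre_sum_smult: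
  assumes "\<phi> \<in> carrier M" "c \<in> carrier R"
  shows "fibre_sum (c \<odot>\<^bsub>M\<^esub> \<phi>) q = c \<otimes> fibre_sum \<phi> q"
proof -
  note \<phi> = M_D[OF assms(1)]
  let ?A = "{x. \<phi> x \<noteq> \<zero> \<and> T x = q}"
  have fin: "finite ?A" by (rule finite_subset[OF _ \<phi>(3)]) auto
  have "fibre_sum (c \<odot>\<^bsub>M\<^esub> \<phi>) q = (\<Oplus>x\<in>?A. c \<otimes> \<phi> x)"
    unfolding M_ops by (rule fibre_sum_eq[OF fin, symmetric]) (use \<phi>(1) assms(2) in auto)
  also have "\<dots> = c \<otimes> (\<Oplus>x\<in>?A. \<phi> x)"
    by (rule R.finsum_rdistr[symmetric]) (use fin \<phi>(1) assms(2) in auto)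
  finally show ?thesis by (simp add: fibre_sum_def)
qed

text \<open>Push-forward along \<open>T\<close> commutes with the action. On the space of paths, \<open>p\<^sub>A\<close> keeps or kills the
  value at \<open>q\<close>, \<open>s\<^sub>e\<close> moves the value at \<open>q\<close> to \<open>e q\<close>, and \<open>s\<^sub>e\<^sup>*\<close> moves it back. So each
  fibre sum of the new function is zero or a fibre sum of the old one; this weak form is all that
  the invariance of the kernel needs.\<close>

lemma fibre_sum_gen_action:
  assumes g: "g \<in> leavitt_gens G" and \<phi>M: "\<phi> \<in> carrier M"
  shows "fibre_sum (gen_action R G X g \<phi>) q \<in> insert \<zero> (range (fibre_sum \<phi>))"
proof -
  let ?\<psi> = "gen_action R G X g \<phi>"
  note \<phi> = M_D[OF \<phi>M]
  let ?S = "{x. ?\<psi> x \<noteq> \<zero> \<and> T x = q}"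
  have "\<exists>q'. fibre_sum ?\<psi> q = fibre_sum \<phi> q'" if ne: "?S \<noteq> {}"
  proof -
    from ne obtain x where x: "?\<psi> x \<noteq> \<zero>" "T x = q" by blast
    from g show ?thesis
    proof (cases rule: leavitt_gens_cases)
      case (Proj A)
      then have "x \<in> D_set X A" using x by (auto split: if_splits)
      then have src: "path_src G q \<in> A" using T_D[OF Proj(1), of x] D_sub[OF Proj(1)] x by auto
      have "?\<psi> z = \<phi> z" if "T z = q" for z
        using that src T_D[OF Proj(1), of z] \<phi>(2)[of z] Proj(2) by (cases "\<phi> z = \<zero>") auto
      then have "fibre_sum ?\<psi> q = fibre_sum \<phi> q"
        unfolding fibre_sum_def by (intro R.add.finprod_cong') (use \<phi>(1) in auto)
      then show ?thesis by blast
    next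
      case (Edge e)
      then have "x \<in> R_set X e" using x by (auto split: if_splits)
      then obtain y where y: "y \<in> D_set X (rng G e)" "x = g_map X e y"
        using g_bij[OF Edge(1)] by (auto simp: bij_betw_def)
      have q: "q = path_cons e (T y)" using T_g[OF Edge(1) y(1)] y(2) x(2) by simp
      have src: "path_src G (T y) \<in> rng G e"
        using T_D[OF vertex_sets.range[OF Edge(1)]] g_props(1)[OF Edge(1) y(1)] y(1) by blast
      let ?A = "{z. \<phi> z \<noteq> \<zero> \<and> T z = T y}"
      have A: "z \<in> D_set X (rng G e)" if "z \<in> ?A" for z
        using that src T_D[OF vertex_sets.range[OF Edge(1)], of z] \<phi>(2)[of z] by simp
      have act: "?\<psi> (g_map X e z) = \<phi> z" if "z \<in> D_set X (rng G e)" for z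
        using Edge_action_g[OF Edge(1) that] Edge(2) by (simp del: gen_action.simps)
      \<comment> \<open>\<open>g\<^sub>e\<close> carries the whole fibre over \<open>T y\<close> onto the fibre over \<open>e (T y)\<close>: one point of the former
        in the domain of \<open>g\<^sub>e\<close> puts all of them there.\<close>
      have "?S = g_map X e ` ?A"
      proof (intro equalityI subsetI)
        fix w assume w: "w \<in> ?S"
        then have "w \<in> R_set X e" using Edge(2) by (auto split: if_splits)
        then obtain z where z: "z \<in> D_set X (rng G e)" "w = g_map X e z"
          using g_bij[OF Edge(1)] by (auto simp: bij_betw_def)
        with w act[OF z(1)] T_g[OF Edge(1) z(1)] q show "w \<in> g_map X e ` ?A" by auto
      next
        fix w assume "w \<in> g_map X e ` ?A"
        then obtain z where z: "z \<in> ?A" "w = g_map X e z" by blast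
        with act[OF A[OF z(1)]] T_g[OF Edge(1) A[OF z(1)]] q show "w \<in> ?S" by simp
      qed
      then have "fibre_sum ?\<psi> q = (\<Oplus>x\<in>g_map X e ` ?A. ?\<psi> x)" by (simp add: fibre_sum_def)
      also have "\<dots> = (\<Oplus>z\<in>?A. ?\<psi> (g_map X e z))"
      proof (rule R.add.finprod_reindex)
        show "?\<psi> \<in> g_map X e ` ?A \<rightarrow> carrier R" using M_D(1)[OF gen_action_closed[OF g \<phi>M]] by blast
        show "inj_on (g_map X e) ?A"
          using A by (intro inj_on_subset[OF bij_betw_imp_inj_on[OF g_bij[OF Edge(1)]]]) blast
      qed
      also have "\<dots> = fibre_sum \<phi> (T y)"
        unfolding fibre_sum_def
        by (rule R.add.finprod_cong'[OF HOL.refl]) (use \<phi>(1) act[OF A] in blast)+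
      finally show ?thesis by blast
    next
      case (Ghost e)
      have act: "?\<psi> z = (if z \<in> D_set X (rng G e) then \<phi> (g_map X e z) else \<zero>)" for z
        using Ghost(2) by simp
      have S: "z \<in> D_set X (rng G e)" if "z \<in> ?S" for z
        using that act[of z] by (auto split: if_splits)
      let ?A = "{z. \<phi> z \<noteq> \<zero> \<and> T z = path_cons e q}"
      \<comment> \<open>Every point labelled \<open>e q\<close> is an image under \<open>g\<^sub>e\<close>, so no part of that fibre is lost.\<close>
      have "?A = g_map X e ` ?S"
      proof (intro equalityI subsetI)
        fix w assume w: "w \<in> ?A"
        then obtain z where "z \<in> D_set X (rng G e)" "w = g_map X e z" "T z = q"
          using T_cons[OF Ghost(1)] \<phi>(2) by blast
        with w act[of z] show "w \<in> g_map X e ` ?S" by auto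
      next
        fix w assume "w \<in> g_map X e ` ?S"
        then obtain z where z: "z \<in> ?S" "w = g_map X e z" by blast
        with act[of z] S[OF z(1)] T_g[OF Ghost(1) S[OF z(1)]] show "w \<in> ?A" by simp
      qed
      then have "fibre_sum \<phi> (path_cons e q) = (\<Oplus>x\<in>g_map X e ` ?S. \<phi> x)" by (simp add: fibre_sum_def)
      also have "\<dots> = (\<Oplus>z\<in>?S. \<phi> (g_map X e z))"
      proof (rule R.add.finprod_reindex)
        show "\<phi> \<in> g_map X e ` ?S \<rightarrow> carrier R" using \<phi>(1) by blast
        show "inj_on (g_map X e) ?S"
          using S by (intro inj_on_subset[OF bij_betw_imp_inj_on[OF g_bij[OF Ghost(1)]]]) blast
      qed
      also have "\<dots> = fibre_sum ?\<psi> q"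
        unfolding fibre_sum_def
      proof (rule R.add.finprod_cong'[OF HOL.refl])
        show "?\<psi> \<in> ?S \<rightarrow> carrier R" using M_D(1)[OF gen_action_closed[OF g \<phi>M]] by blast
        show "\<phi> (g_map X e z) = ?\<psi> z" if "z \<in> ?S" for z using act[of z] S[OF that] by simp
      qed
      finally show ?thesis by metis
    qed
  qed
  moreover have "fibre_sum ?\<psi> q = \<zero>" if "?S = {}"
    unfolding fibre_sum_def that by (rule R.finsum_empty)
  ultimately show ?thesis by blast
qed

text \<open>Two points with the same label would make the kernel of the push-forward a proper nonzero
  submodule: it contains the difference of their point masses, but neither point mass. An example is
  a loop \<open>e\<close> at a single vertex with \<open>g\<^sub>e\<close> swapping two points.\<close>

lemma irreducible_imp_inj_on:
  assumes irr: irreducible_rep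
  shows "inj_on T (pts X)"
proof (rule inj_onI, rule ccontr)
  fix x y assume x: "x \<in> pts X" and y: "y \<in> pts X" and Txy: "T x = T y" and xy: "x \<noteq> y"
  let ?N = "{\<phi> \<in> carrier M. \<forall>q. fibre_sum \<phi> q = \<zero>}"
  have "invariant ?N"
  proof (rule invariantI)
    show "gen_action R G X g \<phi> \<in> ?N" if "g \<in> leavitt_gens G" "\<phi> \<in> ?N" for g \<phi>
      using that fibre_sum_gen_action[of g \<phi>] gen_action_closed[of g \<phi>] by (auto simp del: gen_action.simps)
    show "\<zero>\<^bsub>M\<^esub> \<in> ?N" using M.M.zero_closed by (simp add: fibre_sum_def M_ops)
  qed (auto simp: fibre_sum_add fibre_sum_smult)
  let ?\<delta> = "\<lambda>z. if z = x then \<one> else if z = y then \<ominus> \<one> else \<zero>"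
  have "{z. ?\<delta> z \<noteq> \<zero>} \<subseteq> {x, y}" by auto
  then have "finite {z. ?\<delta> z \<noteq> \<zero>}" by (rule finite_subset) simp
  then have \<delta>: "?\<delta> \<in> carrier M" using x y by (auto simp: M_carrier)
  have "fibre_sum ?\<delta> q = \<zero>" for q
  proof (cases "q = T x")
    case True
    have "fibre_sum ?\<delta> q = (\<Oplus>z\<in>{x, y}. ?\<delta> z)"
      by (rule fibre_sum_eq[symmetric]) (use True Txy in \<open>auto split: if_splits\<close>)
    also have "\<dots> = \<zero>" using xy by (subst R.finsum_insert) (auto simp: R.r_neg)
    finally show ?thesis .
  next
    case False
    then have "{z. ?\<delta> z \<noteq> \<zero> \<and> T z = q} = {}" using Txy by auto
    then show ?thesis unfolding fibre_sum_def by (simp only: R.finsum_empty)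
  qed
  with \<delta> have "?\<delta> \<in> ?N" by simp
  moreover have "?\<delta> \<noteq> \<zero>\<^bsub>M\<^esub>"
  proof
    assume "?\<delta> = \<zero>\<^bsub>M\<^esub>"
    from fun_cong[OF this, of x] show False by (simp add: M_ops)
  qed
  ultimately have "?N \<noteq> {\<zero>\<^bsub>M\<^esub>}" by blast
  moreover have "point_mass x \<notin> ?N"
  proof -
    have "fibre_sum (point_mass x) (T x) = (\<Oplus>z\<in>{x}. point_mass x z)"
      by (rule fibre_sum_eq[symmetric]) (auto simp: point_mass_def split: if_splits)
    also have "\<dots> \<noteq> \<zero>" by (simp add: point_mass_def)
    finally show ?thesis by blast
  qed
  ultimately show False
    using irr \<open>invariant ?N\<close> point_mass_carrier[OF x] unfolding irreducible_rep_iff by blast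
qed

text \<open>The functions supported on a union of orbits form an invariant submodule.\<close>

lemma irreducible_imp_single_orbit:
  assumes irr: irreducible_rep and orb: "orbit_closed S" and ne: "S \<noteq> {}"
  shows "S = pts X"
proof (rule ccontr)
  have S: "S \<subseteq> pts X" and closed: "\<And>e x. \<lbrakk>e \<in> edges G; x \<in> D_set X (rng G e)\<rbrakk> \<Longrightarrow> x \<in> S \<longleftrightarrow> g_map X e x \<in> S"
    using orb by (simp_all add: orbit_closed_def)
  assume "S \<noteq> pts X"
  with S ne obtain x y where x: "x \<in> S" and y: "y \<in> pts X" "y \<notin> S" by blast
  let ?N = "{\<phi> \<in> carrier M. \<forall>z. \<phi> z \<noteq> \<zero> \<longrightarrow> z \<in> S}"
  have "invariant ?N"
  proof (rule invariantI)
    fix g \<phi> assume g: "g \<in> leavitt_gens G" and \<phi>: "\<phi> \<in> ?N"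
    have "z \<in> S" if z: "gen_action R G X g \<phi> z \<noteq> \<zero>" for z
      using g
    proof (cases rule: leavitt_gens_cases)
      case (Proj A)
      with z \<phi> show ?thesis by (auto split: if_splits)
    next
      case (Edge e)
      with z have "z \<in> R_set X e" by (auto split: if_splits)
      then obtain w where w: "w \<in> D_set X (rng G e)" "z = g_map X e w"
        using g_bij[OF Edge(1)] by (auto simp: bij_betw_def)
      with z Edge Edge_action_g[OF Edge(1) w(1), of \<phi>] have "\<phi> w \<noteq> \<zero>" by (simp del: gen_action.simps)
      with \<phi> closed[OF Edge(1) w(1)] w(2) show ?thesis by auto
    next
      case (Ghost e)
      with z have "z \<in> D_set X (rng G e)" "\<phi> (g_map X e z) \<noteq> \<zero>" by (auto split: if_splits)
      with \<phi> closed[OF Ghost(1)] show ?thesis by auto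
    qed
    with gen_action_closed[OF g] \<phi> show "gen_action R G X g \<phi> \<in> ?N" by blast
  next
    show "\<phi> \<oplus>\<^bsub>M\<^esub> \<chi> \<in> ?N" if "\<phi> \<in> ?N" "\<chi> \<in> ?N" for \<phi> \<chi>
    proof -
      have "\<phi> \<oplus>\<^bsub>M\<^esub> \<chi> \<in> carrier M" using that M.M.a_closed by blast
      moreover have "z \<in> S" if "(\<phi> \<oplus>\<^bsub>M\<^esub> \<chi>) z \<noteq> \<zero>" for z
      proof -
        from that have "\<phi> z \<noteq> \<zero> \<or> \<chi> z \<noteq> \<zero>" by (auto simp: M_ops)
        with \<open>\<phi> \<in> ?N\<close> \<open>\<chi> \<in> ?N\<close> show ?thesis by blast
      qed
      ultimately show ?thesis by blast
    qed
    show "c \<odot>\<^bsub>M\<^esub> \<phi> \<in> ?N" if "c \<in> carrier R" "\<phi> \<in> ?N" for c \<phi>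
    proof -
      have "c \<odot>\<^bsub>M\<^esub> \<phi> \<in> carrier M" using that M.smult_closed by blast
      moreover have "\<phi> z \<noteq> \<zero>" if "(c \<odot>\<^bsub>M\<^esub> \<phi>) z \<noteq> \<zero>" for z
        using that \<open>c \<in> carrier R\<close> by (auto simp: M_ops)
      ultimately show ?thesis using that by blast
    qed
  qed (use M.M.zero_closed in \<open>auto simp: M_ops\<close>)
  moreover have "point_mass x \<in> ?N" using x S point_mass_carrier by (auto simp: point_mass_def)
  moreover have "point_mass y \<notin> ?N" using y(2) by (auto simp: point_mass_def)
  ultimately show False
    using irr point_mass_carrier[OF y(1)] point_mass_nonzero[of x] unfolding irreducible_rep_iff by blast
qed

end


section \<open>Injectivity and a single class force irreducibility\<close>

context labelled_representation
begin

definition minimal_support :: "('x \<Rightarrow> 'k) set \<Rightarrow> ('x \<Rightarrow> 'k) \<Rightarrow> bool"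
  where "minimal_support N \<phi> \<longleftrightarrow> is_arg_min (\<lambda>\<phi>. card {x. \<phi> x \<noteq> \<zero>}) (\<lambda>\<phi>. \<phi> \<in> N \<and> (\<exists>x. \<phi> x \<noteq> \<zero>)) \<phi>"

text \<open>Being together in a minimal support is a bisimulation of labels. A generator that keeps one point
  of the support cannot remove another one, because the result would be nonzero with a smaller
  support. So \<open>p\<^sub>v\<close> shows that a sink is common to all points, and \<open>s\<^sub>e\<^sup>*\<close> that
  a first edge is common to all of them and gives a function of minimal support in which the
  first edge has been removed from all the labels.\<close>

lemma minimal_support_T_const:
  assumes N: "invariant N" and \<phi>: "minimal_support N \<phi>" and xy: "\<phi> x \<noteq> \<zero>" "\<phi> y \<noteq> \<zero>"
  shows "T x = T y"
proof (rule path_bisimulation)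
  let ?B = "{(T x, T y) | x y. \<exists>\<phi>. minimal_support N \<phi> \<and> \<phi> x \<noteq> \<zero> \<and> \<phi> y \<noteq> \<zero>}"
  show "(T x, T y) \<in> ?B" using \<phi> xy by blast
  have min: "\<phi> \<in> N" "\<And>\<psi> z. \<lbrakk>\<psi> \<in> N; \<psi> z \<noteq> \<zero>\<rbrakk> \<Longrightarrow> card {x. \<phi> x \<noteq> \<zero>} \<le> card {x. \<psi> x \<noteq> \<zero>}"
    if "minimal_support N \<phi>" for \<phi>
    using that by (auto simp: minimal_support_def is_arg_min_linorder)
  show "q = Fin_path [] v" if vq: "(Fin_path [] v, q) \<in> ?B" for v q
  proof -
    from vq obtain x y \<phi> where \<phi>: "minimal_support N \<phi>" "\<phi> x \<noteq> \<zero>" "\<phi> y \<noteq> \<zero>"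
      and Tx: "T x = Fin_path [] v" and q: "q = T y" by (auto dest: sym)
    note \<phi>M = M_D[OF invariantD(1)[OF N min(1)[OF \<phi>(1)]]]
    note x = \<phi>M(2)[OF \<phi>(2)] and y = \<phi>M(2)[OF \<phi>(3)]
    have v: "v \<in> sinks G" using first_edge_None[OF T_path[OF x]] Tx by simp
    then have V: "{v} \<in> vertex_sets G" by (auto simp: sinks_def intro: vertex_sets.singleton)
    let ?\<psi> = "gen_action R G X (Proj {v}) \<phi>"
    have "?\<psi> \<in> N" by (rule invariantD(5)[OF N _ min(1)[OF \<phi>(1)]]) (use V in \<open>simp add: leavitt_gens_def\<close>)
    moreover have "?\<psi> x \<noteq> \<zero>" using T_D[OF V x] Tx \<phi>(2) by simp
    ultimately have "card {x. \<phi> x \<noteq> \<zero>} \<le> card {x. ?\<psi> x \<noteq> \<zero>}" by (rule min(2)[OF \<phi>(1)])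
    then have "{x. ?\<psi> x \<noteq> \<zero>} = {x. \<phi> x \<noteq> \<zero>}" by (intro card_seteq \<phi>M(3)) auto
    then have "?\<psi> y \<noteq> \<zero>" using \<phi>(3) by blast
    then have "path_src G (T y) = v" using T_D[OF V y] by (auto split: if_splits)
    then show ?thesis using first_edge_None[OF T_path[OF y]] v q first_edge_NoneD by metis
  qed
  show "\<exists>q'. q = path_cons e q' \<and> (p, q') \<in> ?B" if pq: "(path_cons e p, q) \<in> ?B" for e p q
  proof -
    from pq obtain x y \<phi> where \<phi>: "minimal_support N \<phi>" "\<phi> x \<noteq> \<zero>" "\<phi> y \<noteq> \<zero>"
      and Tx: "T x = path_cons e p" and q: "q = T y" by (auto dest: sym)
    note \<phi>M = M_D[OF invariantD(1)[OF N min(1)[OF \<phi>(1)]]]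
    note x = \<phi>M(2)[OF \<phi>(2)]
    have e: "e \<in> edges G" using first_edge_src(1)[OF T_path[OF x]] Tx by simp
    obtain x' where x': "x' \<in> D_set X (rng G e)" "x = g_map X e x'" "T x' = p"
      using T_cons[OF e x Tx] by blast
    let ?\<psi> = "gen_action R G X (Ghost e) \<phi>"
    let ?S = "{x. ?\<psi> x \<noteq> \<zero>}"
    have \<psi>N: "?\<psi> \<in> N" by (rule invariantD(5)[OF N _ min(1)[OF \<phi>(1)]]) (use e in \<open>simp add: leavitt_gens_def\<close>)
    have \<psi>x': "?\<psi> x' \<noteq> \<zero>" using x' \<phi>(2) by simp
    have S: "z \<in> D_set X (rng G e)" "\<phi> (g_map X e z) \<noteq> \<zero>" if "z \<in> ?S" for z
      using that by (auto split: if_splits)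
    have "inj_on (g_map X e) ?S"
      using S(1) by (intro inj_on_subset[OF bij_betw_imp_inj_on[OF g_bij[OF e]]]) blast
    then have card: "card (g_map X e ` ?S) = card ?S" by (rule card_image)
    moreover have "card {x. \<phi> x \<noteq> \<zero>} \<le> card ?S" by (rule min(2)[OF \<phi>(1) \<psi>N \<psi>x'])
    \<comment> \<open>Minimality leaves no room: \<open>g\<^sub>e\<close> maps the new support onto the old one.\<close>
    ultimately have eq: "g_map X e ` ?S = {x. \<phi> x \<noteq> \<zero>}"
      by (intro card_seteq \<phi>M(3)) (use S(2) in auto)
    then obtain y' where y': "y' \<in> ?S" "y = g_map X e y'" using \<phi>(3) by blast
    have "card ?S = card {x. \<phi> x \<noteq> \<zero>}" using card eq by simp
    then have "minimal_support N ?\<psi>"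
      using \<phi>(1) \<psi>N \<psi>x' unfolding minimal_support_def is_arg_min_linorder by metis
    then have "(T x', T y') \<in> ?B" using \<psi>x' y'(1) by blast
    then show ?thesis using q y'(2) T_g[OF e S(1)[OF y'(1)]] x'(3) by blast
  qed
qed

text \<open>Here the scalars have to form a field: the one remaining value is made equal to one.\<close>

lemma invariant_point_mass:
  assumes N: "invariant N" and ne: "N \<noteq> {\<zero>\<^bsub>M\<^esub>}" and inj: "inj_on T (pts X)"
  obtains x where "x \<in> pts X" "point_mass x \<in> N"
proof -
  from ne invariantD(2)[OF N] obtain \<chi> where "\<chi> \<in> N" "\<chi> \<noteq> \<zero>\<^bsub>M\<^esub>" by blast
  then have \<chi>: "\<chi> \<in> N \<and> (\<exists>x. \<chi> x \<noteq> \<zero>)" by (auto simp: M_ops)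
  obtain \<phi> where \<phi>0: "is_arg_min (\<lambda>\<phi>. card {x. \<phi> x \<noteq> \<zero>}) (\<lambda>\<phi>. \<phi> \<in> N \<and> (\<exists>x. \<phi> x \<noteq> \<zero>)) \<phi>"
    using ex_has_least_nat[of "\<lambda>\<phi>. \<phi> \<in> N \<and> (\<exists>x. \<phi> x \<noteq> \<zero>)", OF \<chi>,
        of "\<lambda>\<phi>. card {x. \<phi> x \<noteq> \<zero>}"]
    unfolding is_arg_min_linorder by (elim exE)
  then have \<phi>: "minimal_support N \<phi>" by (simp only: minimal_support_def)
  from \<phi>0 obtain x where \<phi>N: "\<phi> \<in> N" and x: "\<phi> x \<noteq> \<zero>" unfolding is_arg_min_def by (elim conjE exE)
  note \<phi>M = M_D[OF invariantD(1)[OF N \<phi>N]]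
  have supp: "y = x" if "\<phi> y \<noteq> \<zero>" for y
    using inj_onD[OF inj minimal_support_T_const[OF N \<phi> that x]] \<phi>M(2) that x by blast
  have U: "\<phi> x \<in> Units R" using \<phi>M(1) x by (simp add: R.field_Units)
  have "inv (\<phi> x) \<odot>\<^bsub>M\<^esub> \<phi> = point_mass x"
  proof
    fix y show "(inv (\<phi> x) \<odot>\<^bsub>M\<^esub> \<phi>) y = point_mass x y"
    proof (cases "y = x")
      case True
      then show ?thesis using R.Units_l_inv[OF U] by (simp add: M_ops point_mass_def)
    next
      case False
      then have "\<phi> y = \<zero>" using supp by blast
      then show ?thesis using False R.r_null[OF R.Units_inv_closed[OF U]]
        by (simp add: M_ops point_mass_def)
    qed
  qed
  with invariantD(4)[OF N R.Units_inv_closed[OF U] \<phi>N] have "point_mass x \<in> N" by simp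
  with that \<phi>M(2)[OF x] show ?thesis by blast
qed

lemma point_masses_orbit_closed:
  assumes N: "invariant N"
  shows "orbit_closed {x \<in> pts X. point_mass x \<in> N}"
  unfolding orbit_closed_def
proof (intro conjI ballI)
  fix e x assume e: "e \<in> edges G" and x: "x \<in> D_set X (rng G e)"
  have gens: "Edge e \<in> leavitt_gens G" "Ghost e \<in> leavitt_gens G" using e by (auto simp: leavitt_gens_def)
  have "point_mass x \<in> N \<longleftrightarrow> point_mass (g_map X e x) \<in> N"
    using invariantD(5)[OF N gens(1), of "point_mass x"] Edge_point_mass[OF e x]
      invariantD(5)[OF N gens(2), of "point_mass (g_map X e x)"] Ghost_point_mass[OF e x] by metis
  then show "x \<in> {x \<in> pts X. point_mass x \<in> N} \<longleftrightarrow> g_map X e x \<in> {x \<in> pts X. point_mass x \<in> N}"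
    using g_props[OF e x] by simp
qed simp

lemma irreducibleI:
  assumes inj: "inj_on T (pts X)" and C: "T ` pts X \<in> all_paths G // path_equiv G"
  shows irreducible_rep
  unfolding irreducible_rep_iff
proof (intro conjI allI impI)
  obtain x where x: "x \<in> pts X" using in_quotient_imp_non_empty[OF equiv_path_equiv C] by blast
  from point_mass_nonzero[of x] point_mass_carrier[OF x] show "carrier M \<noteq> {\<zero>\<^bsub>M\<^esub>}" by blast
next
  fix N assume N: "invariant N"
  show "N = {\<zero>\<^bsub>M\<^esub>} \<or> N = carrier M"
  proof (cases "N = {\<zero>\<^bsub>M\<^esub>}")
    case False
    then obtain x where x: "x \<in> pts X" "point_mass x \<in> N" using invariant_point_mass[OF N _ inj] by blast
    have "point_mass y \<in> N" if y: "y \<in> pts X" for y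
    proof -
      have "(T x, T y) \<in> path_equiv G"
        using quotient_eq_iff[OF equiv_path_equiv C C, of "T x" "T y"] x(1) y by blast
      then have "tail_equivalent (T x) (T y)" by (simp add: path_equiv_def)
      then have "T y \<in> T ` {x \<in> pts X. point_mass x \<in> N}"
        using cons_invariant_class[OF cons_invariant_image[OF point_masses_orbit_closed[OF N]]] T_path x y by blast
      with inj y show ?thesis by (auto dest: inj_onD)
    qed
    then show ?thesis using in_invariantI_point_masses[OF N] invariantD(1)[OF N] by blast
  qed simp
qed

lemma irreducible_imp_class:
  assumes irr: irreducible_rep
  shows "T ` pts X \<in> all_paths G // path_equiv G"
proof -
  have "pts X \<noteq> {}"
  proof
    assume "pts X = {}"
    then have "\<phi> x = \<zero>" if "\<phi> \<in> carrier M" for \<phi> x using M_D(2)[OF that] by blast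
    then have "\<phi> = \<zero>\<^bsub>M\<^esub>" if "\<phi> \<in> carrier M" for \<phi> using that by (simp add: M_ops fun_eq_iff)
    then have "carrier M = {\<zero>\<^bsub>M\<^esub>}" using M.M.zero_closed by blast
    with irr show False by (simp add: irreducible_rep_iff)
  qed
  then obtain x where x: "x \<in> pts X" by blast
  let ?C = "path_equiv G `` {T x}"
  have C: "p \<in> ?C \<longleftrightarrow> p \<in> all_paths G \<and> tail_equivalent (T x) p" for p
    using T_path[OF x] by (auto simp: path_equiv_def)
  have eq: "path_cons e p \<in> ?C \<longleftrightarrow> p \<in> ?C" if "p \<in> all_paths G" "path_cons e p \<in> all_paths G" for e p
  proof -
    have "(p, path_cons e p) \<in> path_equiv G"
      using that path_cons_tail[of p e] by (simp add: path_equiv_def)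
    then show ?thesis
      using equivE[OF equiv_path_equiv[of G]] by (metis Image_singleton_iff symD transD)
  qed
  \<comment> \<open>The points labelled in the class of one of them are a union of orbits, so they are all the
    points; then the image of \<open>T\<close> lies in that class and, being closed under adding and removing
    first edges, fills it.\<close>
  have "{y \<in> pts X. T y \<in> ?C} = pts X"
  proof (rule irreducible_imp_single_orbit[OF irr])
    show "{y \<in> pts X. T y \<in> ?C} \<noteq> {}"
      using x equiv_class_self[OF equiv_path_equiv T_path[OF x]] by blast
    have "y \<in> {y \<in> pts X. T y \<in> ?C} \<longleftrightarrow> g_map X e y \<in> {y \<in> pts X. T y \<in> ?C}"
      if "e \<in> edges G" "y \<in> D_set X (rng G e)" for e y
      using eq[of "T y" e] T_path[of y] T_path[of "g_map X e y"] g_props[OF that] T_g[OF that] by simp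
    then show "orbit_closed {y \<in> pts X. T y \<in> ?C}" unfolding orbit_closed_def by blast
  qed
  moreover have "p \<in> T ` pts X" if "p \<in> ?C" for p
  proof (rule cons_invariant_class)
    show "cons_invariant G (T ` pts X)"
      by (rule cons_invariant_image) (auto simp: orbit_closed_def g_props)
    show "T x \<in> T ` pts X" using x by simp
  qed (use that C x T_path in \<open>simp_all only:\<close>)
  ultimately have "T ` pts X = ?C" by blast
  then show ?thesis using quotientI[OF T_path[OF x], of "path_equiv G"] by simp
qed

theorem irreducible_iff_inj_class:
  "irreducible_rep \<longleftrightarrow> inj_on T (pts X) \<and> T ` pts X \<in> all_paths G // path_equiv G"
  using irreducible_imp_inj_on irreducible_imp_class irreducibleI by blast

end


section \<open>The path of a point of a perfect branching system\<close>

definition base_vertex :: "('v, 'e) ultragraph \<Rightarrow> ('v, 'e, 'x) branching \<Rightarrow> 'x \<Rightarrow> 'v"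
  where "base_vertex G X x = (THE v. v \<in> verts G \<and> x \<in> D_set X {v})"

definition edge_at :: "('v, 'e) ultragraph \<Rightarrow> ('v, 'e, 'x) branching \<Rightarrow> 'x \<Rightarrow> 'e"
  where "edge_at G X x = (THE e. e \<in> edges G \<and> x \<in> R_set X e)"

definition halted :: "('v, 'e) ultragraph \<Rightarrow> ('v, 'e, 'x) branching \<Rightarrow> 'x \<Rightarrow> bool"
  where "halted G X x \<longleftrightarrow> (\<forall>e \<in> edges G. x \<notin> R_set X e)"

text \<open>The preimage of a point under the only map \<open>g\<^sub>e\<close> that reaches it: one step along the itinerary.
  The value at a halted point is arbitrary, and \<open>path_of\<close> stops reading there.\<close>

definition shift :: "('v, 'e) ultragraph \<Rightarrow> ('v, 'e, 'x) branching \<Rightarrow> 'x \<Rightarrow> 'x"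
  where "shift G X x = inv_into (D_set X (rng G (edge_at G X x))) (g_map X (edge_at G X x)) x"

definition path_of :: "('v, 'e) ultragraph \<Rightarrow> ('v, 'e, 'x) branching \<Rightarrow> 'x \<Rightarrow> ('v, 'e) path"
  where "path_of G X x =
    (if \<exists>n. halted G X ((shift G X ^^ n) x)
     then let n = LEAST n. halted G X ((shift G X ^^ n) x)
       in Fin_path (map (\<lambda>i. edge_at G X ((shift G X ^^ i) x)) [0..<n]) (base_vertex G X ((shift G X ^^ n) x))
     else Inf_path (\<lambda>n. edge_at G X ((shift G X ^^ n) x)))"

context perfect_branching_system
begin

lemma D_disjoint:
  assumes "A \<in> vertex_sets G" "B \<in> vertex_sets G" "A \<inter> B = {}"
  shows "D_set X A \<inter> D_set X B = {}"
  using D_inter[OF assms(1,2)] by (simp only: assms(3) D_empty)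

lemma base_vertex_eq:
  assumes "v \<in> verts G" "x \<in> D_set X {v}"
  shows "base_vertex G X x = v"
  unfolding base_vertex_def
proof (rule the_equality)
  show "w = v" if w: "w \<in> verts G \<and> x \<in> D_set X {w}" for w
  proof (rule ccontr)
    assume "w \<noteq> v"
    then have "D_set X {w} \<inter> D_set X {v} = {}"
      by (intro D_disjoint vertex_sets.singleton) (use w assms(1) in simp_all)
    with w assms(2) show False by blast
  qed
qed (use assms in blast)

lemma base_vertex:
  assumes "x \<in> pts X"
  shows "base_vertex G X x \<in> verts G" "x \<in> D_set X {base_vertex G X x}"
proof -
  obtain v where v: "v \<in> verts G" "x \<in> D_set X {v}" using assms unfolding pts_cover by blast
  show "base_vertex G X x \<in> verts G" "x \<in> D_set X {base_vertex G X x}"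
    unfolding base_vertex_eq[OF v] by (rule v)+
qed

lemma D_iff_base_vertex:
  assumes A: "A \<in> vertex_sets G" and x: "x \<in> pts X"
  shows "x \<in> D_set X A \<longleftrightarrow> base_vertex G X x \<in> A"
proof -
  let ?v = "base_vertex G X x"
  note v = base_vertex[OF x]
  note V = vertex_sets.singleton[OF v(1)]
  show ?thesis
  proof
    assume "x \<in> D_set X A"
    with v(2) have "D_set X {?v} \<inter> D_set X A \<noteq> {}" by blast
    with D_disjoint[OF V A] show "?v \<in> A" by blast
  next
    assume "?v \<in> A"
    then have "{?v} \<union> A = A" by blast
    with D_union[OF V A] have "D_set X {?v} \<union> D_set X A = D_set X A" by (simp only:)
    with v(2) show "x \<in> D_set X A" by blast
  qed
qed

lemma edge_at_eq:
  assumes "e \<in> edges G" "x \<in> R_set X e"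
  shows "edge_at G X x = e"
  unfolding edge_at_def
proof (rule the_equality)
  show "f = e" if "f \<in> edges G \<and> x \<in> R_set X f" for f
    using R_disj[of f e] assms that by blast
qed (use assms in simp)

lemma shift_g:
  assumes e: "e \<in> edges G" and x: "x \<in> D_set X (rng G e)"
  shows "x \<in> pts X" "\<not> halted G X (g_map X e x)" "edge_at G X (g_map X e x) = e"
    "shift G X (g_map X e x) = x" "base_vertex G X (g_map X e x) = src G e"
    "base_vertex G X x \<in> rng G e"
proof -
  have R: "g_map X e x \<in> R_set X e" using g_bij[OF e] x by (auto dest: bij_betwE)
  show pt: "x \<in> pts X" using D_sub[OF vertex_sets.range[OF e]] x by blast
  show "\<not> halted G X (g_map X e x)" using e R by (auto simp: halted_def)
  show E: "edge_at G X (g_map X e x) = e" by (rule edge_at_eq[OF e R])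
  show "shift G X (g_map X e x) = x"
    unfolding shift_def E by (rule bij_betw_inv_into_left[OF g_bij[OF e] x])
  show "base_vertex G X (g_map X e x) = src G e"
    by (rule base_vertex_eq[OF src_in[OF e]]) (use R_sub_D[OF e] R in blast)
  show "base_vertex G X x \<in> rng G e" using D_iff_base_vertex[OF vertex_sets.range[OF e] pt] x by simp
qed

lemma not_haltedE:
  assumes "\<not> halted G X x"
  obtains e y where "e \<in> edges G" "y \<in> D_set X (rng G e)" "x = g_map X e y"
proof -
  from assms obtain e where e: "e \<in> edges G" "x \<in> R_set X e" by (auto simp: halted_def)
  then obtain y where "y \<in> D_set X (rng G e)" "x = g_map X e y"
    using g_bij[OF e(1)] by (auto simp: bij_betw_def)
  with e that show ?thesis by blast
qed

text \<open>Over a vertex that emits infinitely many edges, an arbitrary branching system may have points in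
  no \<open>R\<^sub>e\<close>, whose itinerary would break off there; perfection excludes them.\<close>

lemma halted_sink:
  assumes x: "x \<in> pts X" and h: "halted G X x"
  shows "base_vertex G X x \<in> sinks G"
proof (rule ccontr)
  assume "base_vertex G X x \<notin> sinks G"
  with base_vertex[OF x] have "x \<in> (\<Union>e\<in>out_edges G (base_vertex G X x). R_set X e)"
    using D_emitter[of "base_vertex G X x"] by blast
  with h show False by (auto simp: halted_def out_edges_def)
qed

lemma path_of_halted: "halted G X x \<Longrightarrow> path_of G X x = Fin_path [] (base_vertex G X x)"
proof -
  assume h: "halted G X x"
  then have "\<exists>n. halted G X ((shift G X ^^ n) x)" by (intro exI[of _ 0]) simp
  moreover have "(LEAST n. halted G X ((shift G X ^^ n) x)) = 0" using h by (intro Least_eq_0) simp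
  ultimately show ?thesis by (simp add: path_of_def)
qed

text \<open>The orbit of \<open>g\<^sub>e x\<close> under \<open>shift\<close> is \<open>g\<^sub>e x\<close> followed by the orbit of \<open>x\<close>.\<close>

lemma path_of_g:
  assumes e: "e \<in> edges G" and x: "x \<in> D_set X (rng G e)"
  shows "path_of G X (g_map X e x) = path_cons e (path_of G X x)"
proof -
  let ?y = "g_map X e x"
  note g = shift_g[OF e x]
  have S: "(shift G X ^^ Suc n) ?y = (shift G X ^^ n) x" for n
    using g(4) by (simp add: funpow_swap1)
  show ?thesis
  proof (cases "\<exists>n. halted G X ((shift G X ^^ n) x)")
    case True
    then obtain n where n: "halted G X ((shift G X ^^ n) x)" by blast
    define m where "m = (LEAST n. halted G X ((shift G X ^^ n) x))"
    have "halted G X ((shift G X ^^ Suc n) ?y)" using n S by simp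
    then have "(LEAST n. halted G X ((shift G X ^^ n) ?y)) = Suc (LEAST n. halted G X ((shift G X ^^ Suc n) ?y))"
      by (rule Least_Suc) (use g(2) in simp)
    then have L: "(LEAST n. halted G X ((shift G X ^^ n) ?y)) = Suc m" unfolding S m_def .
    have ex: "\<exists>n. halted G X ((shift G X ^^ n) ?y)"
      using \<open>halted G X ((shift G X ^^ Suc n) ?y)\<close> by blast
    have "map (\<lambda>i. edge_at G X ((shift G X ^^ i) ?y)) [0..<Suc m]
        = e # map (\<lambda>i. edge_at G X ((shift G X ^^ i) x)) [0..<m]"
      unfolding map_upt_Suc S using g(3) by simp
    then show ?thesis
      using True ex S[of m] unfolding path_of_def L m_def[symmetric] by (simp only: if_True Let_def path_cons.simps)
  next
    case False
    have "\<not> halted G X ((shift G X ^^ n) ?y)" for n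
    proof (cases n)
      case (Suc k)
      with False S[of k] show ?thesis by simp
    qed (use g(2) in simp)
    moreover have "edge_at G X ((shift G X ^^ n) ?y) = case_nat e (\<lambda>n. edge_at G X ((shift G X ^^ n) x)) n" for n
    proof (cases n)
      case (Suc k)
      with S[of k] show ?thesis by simp
    qed (use g(3) in simp)
    ultimately show ?thesis using False by (simp add: path_of_def fun_eq_iff)
  qed
qed

lemma path_src_path_of:
  assumes "x \<in> pts X"
  shows "path_src G (path_of G X x) = base_vertex G X x"
proof (cases "halted G X x")
  case False
  then show ?thesis by (elim not_haltedE) (simp add: path_of_g shift_g(5))
qed (simp add: path_of_halted)

lemma path_of_in_all_paths:
  assumes x: "x \<in> pts X"
  shows "path_of G X x \<in> all_paths G"
proof (cases "\<exists>n. halted G X ((shift G X ^^ n) x)")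
  case True
  then obtain n where "halted G X ((shift G X ^^ n) x)" by blast
  with x show ?thesis
  proof (induction n arbitrary: x)
    case 0
    then show ?case using halted_sink[of x] by (simp add: path_of_halted all_paths_def sink_paths_def)
  next
    case (Suc n)
    show ?case
    proof (cases "halted G X x")
      case True
      then show ?thesis
        using halted_sink[OF Suc.prems(1)] by (simp add: path_of_halted all_paths_def sink_paths_def)
    next
      case False
      then obtain e y where ey: "e \<in> edges G" "y \<in> D_set X (rng G e)" "x = g_map X e y"
        by (rule not_haltedE)
      note g = shift_g[OF ey(1,2)]
      have "path_of G X y \<in> all_paths G"
        using Suc.IH[OF g(1)] Suc.prems(2) ey(3) g(4) by (simp add: funpow_swap1)
      then show ?thesis
        using ey path_cons_mem[OF ey(1), of "path_of G X y"] path_src_path_of[OF g(1)] g(6)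
        by (simp add: path_of_g)
    qed
  qed
next
  case False
  have step: "edge_at G X y \<in> edges G \<and> shift G X y \<in> pts X \<and> base_vertex G X y = src G (edge_at G X y)
      \<and> base_vertex G X (shift G X y) \<in> rng G (edge_at G X y)" if "\<not> halted G X y" for y
    using that by (elim not_haltedE) (simp add: shift_g)
  have "edge_at G X ((shift G X ^^ n) x) \<in> edges G" for n
    using step[of "(shift G X ^^ n) x"] False by blast
  moreover have "src G (edge_at G X ((shift G X ^^ Suc n) x)) \<in> rng G (edge_at G X ((shift G X ^^ n) x))" for n
  proof -
    have "\<not> halted G X ((shift G X ^^ n) x)" "\<not> halted G X (shift G X ((shift G X ^^ n) x))"
      using False by (blast, metis funpow.simps(2) comp_apply)
    from step[OF this(1)] step[OF this(2)] show ?thesis by simp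
  qed
  ultimately show ?thesis
    unfolding path_of_def if_not_P[OF False] all_paths_def infinite_paths_def by blast
qed

lemma path_labelling_path_of: "path_labelling G X (path_of G X)"
proof
  fix x assume x: "x \<in> pts X"
  show "path_of G X x \<in> all_paths G" by (rule path_of_in_all_paths[OF x])
  show "x \<in> D_set X A \<longleftrightarrow> path_src G (path_of G X x) \<in> A" if "A \<in> vertex_sets G" for A
    using D_iff_base_vertex[OF that x] path_src_path_of[OF x] by simp
  show "x \<in> R_set X e \<longleftrightarrow> first_edge (path_of G X x) = Some e" if e: "e \<in> edges G" for e
  proof (cases "halted G X x")
    case True
    with e show ?thesis by (auto simp: path_of_halted halted_def)
  next
    case False
    then obtain f y where y: "f \<in> edges G" "y \<in> D_set X (rng G f)" "x = g_map X f y"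
      by (rule not_haltedE)
    then have "x \<in> R_set X f" using g_bij[OF y(1)] by (auto dest: bij_betwE)
    then have "x \<in> R_set X e \<longleftrightarrow> e = f" using R_disj[OF e y(1)] by blast
    then show ?thesis using y by (auto simp: path_of_g)
  qed
qed (rule path_of_g)

end


section \<open>Irreducible representations and classes of paths\<close>

theorem theorem5p14:
  fixes G :: "('v, 'e) ultragraph"
    and R :: "('k, 'm) ring_scheme"
    and X :: "('v, 'e, 'x) branching"
  assumes "ultragraph G"
    and "field R"
    and "perfect_branching_system G X"
  shows "irreducible_representation R (leavitt_path_algebra R G) (finsupp_maps R (pts X))
           (branching_rep R G X) \<longleftrightarrow>
         (\<exists>C \<in> all_paths G // path_equiv G. branching_isomorphic G X (path_branching G C))"
proof -
  interpret perfect_branching_system G X by (rule assms(3))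
  have C: "C \<subseteq> all_paths G" if "C \<in> all_paths G // path_equiv G" for C
    by (rule in_quotient_imp_subset[OF equiv_path_equiv that])
  have crit: "irreducible_representation R (leavitt_path_algebra R G) (finsupp_maps R (pts X))
      (branching_rep R G X) \<longleftrightarrow> inj_on T (pts X) \<and> T ` pts X \<in> all_paths G // path_equiv G"
    if "path_labelling G X T" for T
    using labelled_representation.irreducible_iff_inj_class[OF labelled_representation.intro[OF that assms(2)]] .
  show ?thesis
  proof
    assume "irreducible_representation R (leavitt_path_algebra R G) (finsupp_maps R (pts X))
      (branching_rep R G X)"
    then have T: "inj_on (path_of G X) (pts X)" "path_of G X ` pts X \<in> all_paths G // path_equiv G"
      using crit[OF path_labelling_path_of] by blast+
    then have "branching_isomorphic G X (path_branching G (path_of G X ` pts X))"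
      by (intro path_labelling.isomorphic_path_branching[OF path_labelling_path_of] C)
        (simp_all add: bij_betw_def)
    with T(2) show "\<exists>C \<in> all_paths G // path_equiv G. branching_isomorphic G X (path_branching G C)"
      by blast
  next
    assume "\<exists>C \<in> all_paths G // path_equiv G. branching_isomorphic G X (path_branching G C)"
    then obtain C where CC: "C \<in> all_paths G // path_equiv G" "branching_isomorphic G X (path_branching G C)"
      by blast
    obtain T where "path_labelling G X T" "bij_betw T (pts X) C"
      by (rule isomorphism_path_labelling[OF CC(2) C[OF CC(1)]])
    with crit CC(1) show "irreducible_representation R (leavitt_path_algebra R G)
      (finsupp_maps R (pts X)) (branching_rep R G X)" by (simp add: bij_betw_def)
  qed
qed

end
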